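(* For all integers $a,b\ge2$ and every integer $k\ge0$, $HP^k(\Lambda(a,b))\cong HP_k(\Lambda(a,b),M_\nu)$ as complex vector spaces.
   Context: For integers $a,b\geq 2$, $\Lambda(a,b):=\mathbb C[X,Y]/(X^a,Y^b)$ with basis $X^iY^j$ ($0\le i\le a-1$, $0\le j\le b-1$) and Poisson bracket determined by $\{X,Y\}=XY$; equivalently $\{X^iY^j,X\}=-jX^{i+1}Y^j$, $\{X^iY^j,Y\}=iX^iY^{j+1}$. $HP^k(\Lambda(a,b))$ is the $k$-th cohomology of the complex $\chi^k$ of skew-symmetric $k$-derivations with Poisson coboundary $\delta_k(P)(f_0,\dots,f_k)=\sum_{i}(-1)^i\{f_i,P(\dots\widehat{f_i}\dots)\}+\sum_{i<j}(-1)^{i+j}P(\{f_i,f_j\},\dots\widehat{f_i}\dots\widehat{f_j}\dots)$. $M_\nu$ is $\Lambda(a,b)$ as a module with external bracket $\{X^iY^j,X\}_{M_\nu}=-(j-b+1)X^{i+1}Y^j$, $\{X^iY^j,Y\}_{M_\nu}=(i-a+1)X^iY^{j+1}$ (extended linearly in the first argument and by $\{m,fg\}_{M_\nu}=\{m,f\}_{M_\nu}g+\{m,g\}_{M_\nu}f$ in the second). $HP_k(\Lambda(a,b),M)$ is the homology of $M\otimes_{\Lambda(a,b)}\Omega^k$, where $\Omega^0=\Lambda(a,b)$, $\Omega^1=(\Lambda(a,b)dX\oplus\Lambda(a,b)dY)/(X^{a-1}dX,Y^{b-1}dY)$, $\Omega^2=\Lambda(a,b)\,dX\wedge dY/(X^{a-1},Y^{b-1})$,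 $\Omega^k=0$ for $k\ge3$, with boundary $\partial_1(m\otimes dX)=\{m,X\}_M$, $\partial_1(m\otimes dY)=\{m,Y\}_M$, $\partial_2(m\otimes dX\wedge dY)=\{m,X\}_M\otimes dY-\{m,Y\}_M\otimes dX-(mX\otimes dY+mY\otimes dX)$. *)

theory Defs
  imports Complex_Main "HOL-Library.Function_Algebras"
begin

text \<open>Elements of Lambda(a,b) = C[X,Y]/(X^a,Y^b) are represented by their coefficient
functions w.r.t. the monomial basis X^i Y^j; the carrier consists of those functions
supported on i < a, j < b.  All vector-space operations are pointwise.\<close>

type_synonym elt = "nat \<times> nat \<Rightarrow> complex"

definition Lam :: "nat \<Rightarrow> nat \<Rightarrow> elt set" where
  "Lam a b = {f. \<forall>i j. (a \<le> i \<or> b \<le> j) \<longrightarrow> f (i, j) = 0}"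

definition scE :: "complex \<Rightarrow> elt \<Rightarrow> elt" where
  "scE c f = (\<lambda>p. c * f p)"

definition monoL :: "nat \<Rightarrow> nat \<Rightarrow> nat \<Rightarrow> nat \<Rightarrow> elt" where
  "monoL a b i j = (\<lambda>p. if p = (i, j) \<and> i < a \<and> j < b then 1 else 0)"

definition lmul :: "nat \<Rightarrow> nat \<Rightarrow> elt \<Rightarrow> elt \<Rightarrow> elt" where
  "lmul a b f g = (\<lambda>(p, q). if p < a \<and> q < b then
      (\<Sum>i\<le>p. \<Sum>j\<le>q. f (i, j) * g (p - i, q - j)) else 0)"

text \<open>Poisson bracket with {X,Y} = XY: {X^i Y^j, X^k Y^l} = (il - jk) X^(i+k) Y^(j+l).\<close>
definition pbr :: "nat \<Rightarrow> nat \<Rightarrow> elt \<Rightarrow> elt \<Rightarrow> elt" where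
  "pbr a b f g = (\<lambda>(p, q). if p < a \<and> q < b then
      (\<Sum>i\<le>p. \<Sum>j\<le>q. (of_nat i * of_nat (q - j) - of_nat j * of_nat (p - i))
                          * f (i, j) * g (p - i, q - j)) else 0)"

text \<open>Argument lists of k-derivations: functions nat => elt, only the first k entries matter.\<close>
definition del :: "nat \<Rightarrow> (nat \<Rightarrow> elt) \<Rightarrow> (nat \<Rightarrow> elt)" where
  "del i f = (\<lambda>n. if n < i then f n else f (Suc n))"

definition pcons :: "elt \<Rightarrow> (nat \<Rightarrow> elt) \<Rightarrow> (nat \<Rightarrow> elt)" where
  "pcons x g = (\<lambda>n. case n of 0 \<Rightarrow> x | Suc m \<Rightarrow> g m)"

text \<open>Skew-symmetric k-derivations of Lambda(a,b) (chi^k), normalised to vanish outside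
Lambda^k and to depend only on the first k arguments.\<close>
definition kder :: "nat \<Rightarrow> nat \<Rightarrow> nat \<Rightarrow> ((nat \<Rightarrow> elt) \<Rightarrow> elt) set" where
  "kder a b k = {P.
     (\<forall>f. (\<exists>i<k. f i \<notin> Lam a b) \<longrightarrow> P f = 0) \<and>
     (\<forall>f g. (\<forall>i<k. f i = g i) \<longrightarrow> P f = P g) \<and>
     (\<forall>f. P f \<in> Lam a b) \<and>
     (\<forall>f i x y c. i < k \<and> (\<forall>j<k. f j \<in> Lam a b) \<and> x \<in> Lam a b \<and> y \<in> Lam a b \<longrightarrow>
        P (f(i := x + scE c y)) = P (f(i := x)) + scE c (P (f(i := y)))) \<and>
     (\<forall>f i x y. i < k \<and> (\<forall>j<k. f j \<in> Lam a b) \<and> x \<in> Lam a b \<and> y \<in> Lam a b \<longrightarrow>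
        P (f(i := lmul a b x y)) = lmul a b x (P (f(i := y))) + lmul a b y (P (f(i := x)))) \<and>
     (\<forall>f i j. i < j \<and> j < k \<longrightarrow> P (f(i := f j, j := f i)) = - P f)}"

definition delta :: "nat \<Rightarrow> nat \<Rightarrow> nat \<Rightarrow> ((nat \<Rightarrow> elt) \<Rightarrow> elt) \<Rightarrow> ((nat \<Rightarrow> elt) \<Rightarrow> elt)" where
  "delta a b k P = (\<lambda>f. if (\<forall>i\<le>k. f i \<in> Lam a b) then
      (\<Sum>i\<le>k. scE ((-1) ^ i) (pbr a b (f i) (P (del i f))))
    + (\<Sum>i\<le>k. \<Sum>j\<le>k. if i < j then
          scE ((-1) ^ (i + j)) (P (pcons (pbr a b (f i) (f j)) (del i (del j f)))) else 0)
    else 0)"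

definition HPZ :: "nat \<Rightarrow> nat \<Rightarrow> nat \<Rightarrow> ((nat \<Rightarrow> elt) \<Rightarrow> elt) set" where
  "HPZ a b k = {P \<in> kder a b k. delta a b k P = 0}"

definition HPB :: "nat \<Rightarrow> nat \<Rightarrow> nat \<Rightarrow> ((nat \<Rightarrow> elt) \<Rightarrow> elt) set" where
  "HPB a b k = (if k = 0 then {0} else delta a b (k - 1) ` kder a b (k - 1))"

definition brX :: "nat \<Rightarrow> nat \<Rightarrow> elt \<Rightarrow> elt" where
  "brX a b m = (\<lambda>(p, q). if p < a \<and> q < b \<and> 0 < p then
      - of_int (int q - int b + 1) * m (p - 1, q) else 0)"

definition brY :: "nat \<Rightarrow> nat \<Rightarrow> elt \<Rightarrow> elt" where
  "brY a b m = (\<lambda>(p, q). if p < a \<and> q < b \<and> 0 < q then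
      of_int (int p - int a + 1) * m (p, q - 1) else 0)"

text \<open>Chains M (x)_Lambda Omega^k, represented by coefficient vectors (index 0 = dX or
dX/\dY or the M-component in degree 0, index 1 = dY), modulo the relation submodule Rel k
(M (x) Lambda/I = M/IM).\<close>
fun rk :: "nat \<Rightarrow> nat" where
  "rk 0 = 1" | "rk (Suc 0) = 2" | "rk (Suc (Suc 0)) = 1" | "rk _ = 0"

definition Chains :: "nat \<Rightarrow> nat \<Rightarrow> nat \<Rightarrow> (nat \<Rightarrow> elt) set" where
  "Chains a b k = {c. \<forall>i. (i < rk k \<longrightarrow> c i \<in> Lam a b) \<and> (rk k \<le> i \<longrightarrow> c i = 0)}"

definition Rel :: "nat \<Rightarrow> nat \<Rightarrow> nat \<Rightarrow> (nat \<Rightarrow> elt) set" where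
  "Rel a b k = (if k = 1 then
       {c. \<exists>m0\<in>Lam a b. \<exists>m1\<in>Lam a b. c = (\<lambda>i. if i = 0 then lmul a b (monoL a b (a - 1) 0) m0
              else if i = 1 then lmul a b (monoL a b 0 (b - 1)) m1 else 0)}
     else if k = 2 then
       {c. \<exists>m\<in>Lam a b. \<exists>m'\<in>Lam a b. c = (\<lambda>i. if i = 0 then
              lmul a b (monoL a b (a - 1) 0) m + lmul a b (monoL a b 0 (b - 1)) m' else 0)}
     else {0})"

definition bd :: "nat \<Rightarrow> nat \<Rightarrow> nat \<Rightarrow> (nat \<Rightarrow> elt) \<Rightarrow> (nat \<Rightarrow> elt)" where
  "bd a b k c = (if k = 1 then
       (\<lambda>i. if i = 0 then brX a b (c 0) + brY a b (c 1) else 0)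
     else if k = 2 then
       (\<lambda>i. if i = 0 then - brY a b (c 0) - lmul a b (c 0) (monoL a b 0 1)
            else if i = 1 then brX a b (c 0) - lmul a b (c 0) (monoL a b 1 0) else 0)
     else 0)"

definition HZ :: "nat \<Rightarrow> nat \<Rightarrow> nat \<Rightarrow> (nat \<Rightarrow> elt) set" where
  "HZ a b k = {c \<in> Chains a b k. bd a b k c \<in> Rel a b (k - 1)}"

definition HB :: "nat \<Rightarrow> nat \<Rightarrow> nat \<Rightarrow> (nat \<Rightarrow> elt) set" where
  "HB a b k = {bd a b (k + 1) c + n | c n. c \<in> Chains a b (k + 1) \<and> n \<in> Rel a b k}"

definition scC :: "complex \<Rightarrow> ((nat \<Rightarrow> elt) \<Rightarrow> elt) \<Rightarrow> ((nat \<Rightarrow> elt) \<Rightarrow> elt)" where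
  "scC c P = (\<lambda>f. scE c (P f))"

definition scV :: "complex \<Rightarrow> (nat \<Rightarrow> elt) \<Rightarrow> (nat \<Rightarrow> elt)" where
  "scV c v = (\<lambda>i. scE c (v i))"

text \<open>Z1/B1 and Z2/B2 are isomorphic complex vector spaces: there is a C-linear map Z1 -> Z2
inducing a bijection Z1/B1 -> Z2/B2.\<close>
definition sq_iso :: "(complex \<Rightarrow> 'a \<Rightarrow> 'a) \<Rightarrow> (complex \<Rightarrow> 'b \<Rightarrow> 'b) \<Rightarrow>
    'a::plus set \<Rightarrow> 'a set \<Rightarrow> 'b::{plus,minus} set \<Rightarrow> 'b set \<Rightarrow> bool" where
  "sq_iso s1 s2 Z1 B1 Z2 B2 \<longleftrightarrow> (\<exists>f.
     (\<forall>x\<in>Z1. \<forall>y\<in>Z1. \<forall>c. f (x + s1 c y) = f x + s2 c (f y)) \<and>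
     f ` Z1 \<subseteq> Z2 \<and>
     (\<forall>z\<in>Z2. \<exists>x\<in>Z1. z - f x \<in> B2) \<and>
     (\<forall>x\<in>Z1. f x \<in> B2 \<longleftrightarrow> x \<in> B1))"

end

theory Submission
  imports Defs "HOL-Computational_Algebra.Formal_Power_Series"
begin

text \<open>With the commuting Euler derivations \<open>E\<^sub>x = X \<partial>\<^sub>x\<close> and \<open>E\<^sub>y = Y \<partial>\<^sub>y\<close> the bracket is
  \<open>{f, g} = E\<^sub>x f E\<^sub>y g - E\<^sub>y f E\<^sub>x g\<close>. A multiderivation is determined by its values on \<open>X\<close> and \<open>Y\<close>,
  and in characteristic 0 the relations \<open>X\<^sup>a = Y\<^sup>b = 0\<close> allow exactly \<open>D X \<in> X\<Lambda>\<close> and \<open>D Y \<in> Y\<Lambda>\<close>; so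
  the Poisson complex splits by multidegree \<open>(i, j)\<close> into (truncated) Koszul complexes of the pair
  \<open>(j, -i)\<close>. These are acyclic except at \<open>(0, 0)\<close> and, in degree 0, at \<open>(a - 1, b - 1)\<close>. Hence
  \<open>HP\<^sup>0\<close>, \<open>HP\<^sup>1\<close>, \<open>HP\<^sup>2\<close> are spanned by \<open>1\<close> and \<open>X\<^sup>a\<^sup>-\<^sup>1Y\<^sup>b\<^sup>-\<^sup>1\<close>, by \<open>E\<^sub>x\<close> and \<open>E\<^sub>y\<close>, and by the bracket
  itself. The twist in \<open>M\<^sub>\<nu>\<close> makes the homology complex the transpose of this complex under
  \<open>(i, j) \<mapsto> (a - 1 - i, b - 1 - j)\<close>, so the same multidegrees survive there.\<close>

section \<open>The truncated polynomial algebra\<close>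

text \<open>Iterated power series, with outer variable X and inner variable Y, let the truncated
  product inherit commutativity and associativity from the ring of formal power series.\<close>

definition fps2 :: "elt \<Rightarrow> complex fps fps" where
  "fps2 f = Abs_fps (\<lambda>i. Abs_fps (\<lambda>j. f (i, j)))"

text \<open>The left factor is an arbitrary series, so that the formula also covers triple
  products.\<close>

lemma fps2_mult_nth:
  "fps_nth (fps_nth (F * fps2 g) p) q
     = (\<Sum>i\<le>p. \<Sum>j\<le>q. fps_nth (fps_nth F i) j * g (p - i, q - j))"
  by (simp add: fps2_def fps_mult_nth fps_sum_nth atLeast0AtMost)

definition Ex :: "elt \<Rightarrow> elt" where
  "Ex f = (\<lambda>(p, q). of_nat p * f (p, q))"

definition Ey :: "elt \<Rightarrow> elt" where
  "Ey f = (\<lambda>(p, q). of_nat q * f (p, q))"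

lemma Ex_linear:
  "Ex (f + g) = Ex f + Ex g" "Ex (f - g) = Ex f - Ex g" "Ex (- f) = - Ex f"
  "Ex (scE c f) = scE c (Ex f)"
  by (auto simp: Ex_def scE_def fun_eq_iff algebra_simps)

lemma Ey_linear:
  "Ey (f + g) = Ey f + Ey g" "Ey (f - g) = Ey f - Ey g" "Ey (- f) = - Ey f"
  "Ey (scE c f) = scE c (Ey f)"
  by (auto simp: Ey_def scE_def fun_eq_iff algebra_simps)

lemma Ey_Ex: "Ey (Ex f) = Ex (Ey f)"
  by (auto simp: Ex_def Ey_def fun_eq_iff)

lemma scE_linear:
  "scE c (f + g) = scE c f + scE c g" "scE c (f - g) = scE c f - scE c g"
  "scE c (- f) = - scE c f" "scE c 0 = 0" "scE 1 f = f" "scE (-1) f = - f" "scE 0 f = 0"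
  by (auto simp: scE_def fun_eq_iff algebra_simps)

lemma sum_apply: "sum g S x = (\<Sum>s\<in>S. g s x)" for g :: "'a \<Rightarrow> 'b \<Rightarrow> complex"
  by (induction S rule: infinite_finite_induct) auto

lemma scE_apply [simp]: "scE c f p = c * f p"
  by (simp add: scE_def)

locale truncated =
  fixes a b :: nat
  assumes a2: "2 \<le> a" and b2: "2 \<le> b"
begin

abbreviation mul :: "elt \<Rightarrow> elt \<Rightarrow> elt" (infixl \<open>\<odot>\<close> 70) where
  "f \<odot> g \<equiv> lmul a b f g"

abbreviation br :: "elt \<Rightarrow> elt \<Rightarrow> elt" where
  "br \<equiv> pbr a b"

abbreviation L :: "elt set" where
  "L \<equiv> Lam a b"

abbreviation mono :: "nat \<Rightarrow> nat \<Rightarrow> elt" where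
  "mono \<equiv> monoL a b"

abbreviation X :: elt where "X \<equiv> mono 1 0"
abbreviation Y :: elt where "Y \<equiv> mono 0 1"

lemma lmul_apply:
  "(f \<odot> g) (p, q) = (if p < a \<and> q < b then fps_nth (fps_nth (fps2 f * fps2 g) p) q else 0)"
  by (simp add: lmul_def fps2_mult_nth) (simp add: fps2_def)

lemma lmul_comm: "f \<odot> g = g \<odot> f"
  by (auto simp: fun_eq_iff lmul_apply mult.commute)

lemma lmul_assoc: "f \<odot> g \<odot> h = f \<odot> (g \<odot> h)"
proof -
  have left: "(f \<odot> g \<odot> h) (p, q) = fps_nth (fps_nth (fps2 f * fps2 g * fps2 h) p) q"
    if "p < a" "q < b" for f g h p q
  proof -
    have "(f \<odot> g \<odot> h) (p, q) = (\<Sum>i\<le>p. \<Sum>j\<le>q. (f \<odot> g) (i, j) * h (p - i, q - j))"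
      using that by (simp add: lmul_def)
    \<comment> \<open>Only positions \<open>i \<le> p < a\<close> and \<open>j \<le> q < b\<close>
      enter, so truncating the inner product loses nothing.\<close>
    also have "\<dots> = (\<Sum>i\<le>p. \<Sum>j\<le>q. fps_nth (fps_nth (fps2 f * fps2 g) i) j * h (p - i, q - j))"
      using that by (intro sum.cong refl) (auto simp: lmul_apply)
    finally show ?thesis by (simp add: fps2_mult_nth)
  qed
  \<comment> \<open>A cyclic rotation suffices: commutativity turns its right side into
    \<open>f \<odot> (g \<odot> h)\<close>.\<close>
  have "(f \<odot> g \<odot> h) (p, q) = (g \<odot> h \<odot> f) (p, q)" for p q
  proof (cases "p < a \<and> q < b")
    case True
    then show ?thesis by (simp add: left mult.commute mult.left_commute)
  qed (auto simp: lmul_apply)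
  then have "f \<odot> g \<odot> h = g \<odot> h \<odot> f" by (auto simp: fun_eq_iff)
  then show ?thesis by (simp add: lmul_comm)
qed

lemma lmul_left_comm: "f \<odot> (g \<odot> h) = g \<odot> (f \<odot> h)"
  by (metis lmul_assoc lmul_comm)

lemma lmul_linear:
  "f \<odot> (g + h) = f \<odot> g + f \<odot> h" "f \<odot> (g - h) = f \<odot> g - f \<odot> h"
  "f \<odot> (- g) = - (f \<odot> g)" "f \<odot> scE c g = scE c (f \<odot> g)" "f \<odot> 0 = 0"
  "(g + h) \<odot> f = g \<odot> f + h \<odot> f" "(g - h) \<odot> f = g \<odot> f - h \<odot> f"
  "(- g) \<odot> f = - (g \<odot> f)" "scE c g \<odot> f = scE c (g \<odot> f)" "0 \<odot> f = 0"
  by (auto simp: fun_eq_iff lmul_def algebra_simps sum.distrib sum_subtractf sum_negf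
      sum_distrib_left)

lemma Lam_closed [intro]:
  "f \<in> L \<Longrightarrow> g \<in> L \<Longrightarrow> f + g \<in> L" "f \<in> L \<Longrightarrow> g \<in> L \<Longrightarrow> f - g \<in> L"
  "f \<in> L \<Longrightarrow> - f \<in> L" "f \<in> L \<Longrightarrow> scE c f \<in> L" "0 \<in> L" "f \<odot> g \<in> L" "br f g \<in> L"
  "mono i j \<in> L"
  by (auto simp: Lam_def lmul_def pbr_def monoL_def)

text \<open>In each term of the convolution the weight splits as
  \<open>p = i + (p - i)\<close>.\<close>

lemma Ex_lmul: "Ex (f \<odot> g) = Ex f \<odot> g + f \<odot> Ex g"
proof -
  have "of_nat p * (f \<odot> g) (p, q) = (Ex f \<odot> g) (p, q) + (f \<odot> Ex g) (p, q)" for p q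
  proof (cases "p < a \<and> q < b")
    case True
    have "of_nat p * (f (i, j) * g (p - i, q - j))
        = Ex f (i, j) * g (p - i, q - j) + f (i, j) * Ex g (p - i, q - j)" if "i \<le> p" for i j
      using that by (simp add: Ex_def of_nat_diff algebra_simps)
    with True show ?thesis
      by (simp add: lmul_def sum_distrib_left flip: sum.distrib)
  qed (auto simp: lmul_apply)
  then show ?thesis by (auto simp: Ex_def fun_eq_iff)
qed

lemma Ey_lmul: "Ey (f \<odot> g) = Ey f \<odot> g + f \<odot> Ey g"
proof -
  have "of_nat q * (f \<odot> g) (p, q) = (Ey f \<odot> g) (p, q) + (f \<odot> Ey g) (p, q)" for p q
  proof (cases "p < a \<and> q < b")
    case True
    have "of_nat q * (f (i, j) * g (p - i, q - j))
        = Ey f (i, j) * g (p - i, q - j) + f (i, j) * Ey g (p - i, q - j)" if "j \<le> q" for i j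
      using that by (simp add: Ey_def of_nat_diff algebra_simps)
    with True show ?thesis
      by (simp add: lmul_def sum_distrib_left flip: sum.distrib)
  qed (auto simp: lmul_apply)
  then show ?thesis by (auto simp: Ey_def fun_eq_iff)
qed

text \<open>The coefficient il - jk is the determinant of the Euler weights. Through this formula
  the bracket identities below reduce to Leibniz rules for \<open>Ex\<close> and
  \<open>Ey\<close>.\<close>

lemma pbr_eq: "br f g = Ex f \<odot> Ey g - Ey f \<odot> Ex g"
  by (auto simp: fun_eq_iff pbr_def lmul_def Ex_def Ey_def algebra_simps sum_subtractf)

lemma mono_lmul_apply:
  "(mono i j \<odot> f) (p, q) = (if i \<le> p \<and> j \<le> q \<and> p < a \<and> q < b then f (p - i, q - j) else 0)"
proof (cases "p < a \<and> q < b")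
  case True
  have "(mono i j \<odot> f) (p, q)
      = (\<Sum>i'\<le>p. \<Sum>j'\<le>q. if i' = i then if j' = j then f (p - i, q - j) else 0 else 0)"
    using True unfolding lmul_def by (auto simp: monoL_def intro!: sum.cong)
  also have "\<dots> = (\<Sum>i'\<le>p. if i' = i then \<Sum>j'\<le>q. if j' = j then f (p - i, q - j) else 0 else 0)"
    by (intro sum.cong) auto
  finally show ?thesis using True by simp
qed (auto simp: lmul_apply)

lemma mono_mult: "mono i j \<odot> mono k l = mono (i + k) (j + l)"
  by (auto simp: fun_eq_iff mono_lmul_apply) (auto simp: monoL_def)

lemma mono_0_lmul: "f \<in> L \<Longrightarrow> mono 0 0 \<odot> f = f"
  by (auto simp: fun_eq_iff mono_lmul_apply Lam_def)

lemma Euler_mono: "Ex (mono i j) = scE (of_nat i) (mono i j)" "Ey (mono i j) = scE (of_nat j) (mono i j)"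
  by (auto simp: Ex_def Ey_def monoL_def fun_eq_iff)

lemma pbr_X: "br X g = X \<odot> Ey g" and pbr_Y: "br Y g = - (Y \<odot> Ex g)"
  by (simp_all add: pbr_eq Euler_mono lmul_linear scE_linear)

lemma Lam_expand:
  assumes "f \<in> L"
  shows "f = (\<Sum>(i, j)\<in>{..<a} \<times> {..<b}. scE (f (i, j)) (mono i j))"
proof
  fix x :: "nat \<times> nat"
  have fin: "finite ({..<a} \<times> {..<b})" by simp
  have "(\<Sum>(i, j)\<in>{..<a} \<times> {..<b}. scE (f (i, j)) (mono i j)) x
      = (\<Sum>y\<in>{..<a} \<times> {..<b}. if y = x then f x else 0)"
    unfolding sum_apply by (rule sum.cong) (auto simp: monoL_def)
  also have "\<dots> = f x"
    using fin assms by (cases x) (auto simp: Lam_def)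
  finally show "f x = (\<Sum>(i, j)\<in>{..<a} \<times> {..<b}. scE (f (i, j)) (mono i j)) x" by simp
qed

section \<open>Derivations\<close>

text \<open>The conditions are imposed on \<open>L\<close> only and have the shape of the clauses of
  \<open>kder\<close>, so that a single slot of a multiderivation fits.\<close>

definition der :: "(elt \<Rightarrow> elt) \<Rightarrow> bool" where
  "der D \<longleftrightarrow> (\<forall>x\<in>L. D x \<in> L) \<and> (\<forall>x\<in>L. \<forall>y\<in>L. \<forall>c. D (x + scE c y) = D x + scE c (D y)) \<and>
     (\<forall>x\<in>L. \<forall>y\<in>L. D (x \<odot> y) = x \<odot> D y + y \<odot> D x)"

lemma derD:
  assumes "der D" "x \<in> L" "y \<in> L"
  shows "D x \<in> L" "D (x + scE c y) = D x + scE c (D y)" "D (x \<odot> y) = x \<odot> D y + y \<odot> D x"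
  using assms unfolding der_def by auto

lemma der_add: "der D \<Longrightarrow> x \<in> L \<Longrightarrow> y \<in> L \<Longrightarrow> D (x + y) = D x + D y"
  using derD(2)[of D x y 1] by (simp add: scE_linear)

lemma der_0: "der D \<Longrightarrow> D 0 = 0"
  using der_add[of D 0 0] Lam_closed(5) by simp

lemma der_scE: "der D \<Longrightarrow> x \<in> L \<Longrightarrow> D (scE c x) = scE c (D x)"
  using derD(2)[of D 0 x c] by (simp only: der_0 Lam_closed(5) add_0_left)

lemma der_sum:
  assumes "der D" "finite S" "\<And>s. s \<in> S \<Longrightarrow> g s \<in> L"
  shows "D (sum g S) = (\<Sum>s\<in>S. D (g s)) \<and> sum g S \<in> L"
  using assms(2,3)
  by (induction S rule: finite_induct) (auto simp: der_0[OF assms(1)] der_add[OF assms(1)])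

lemma der_one:
  assumes "der D"
  shows "D (mono 0 0) = 0"
proof -
  have "D (mono 0 0) \<in> L" using derD(1)[OF assms] by blast
  moreover have "D (mono 0 0 \<odot> mono 0 0) = mono 0 0 \<odot> D (mono 0 0) + mono 0 0 \<odot> D (mono 0 0)"
    by (rule derD(3)[OF assms]) auto
  ultimately show ?thesis by (simp add: mono_mult mono_0_lmul)
qed

text \<open>The Leibniz rule carries equality from the generators to powers of Y and then to all
  monomials; linearity does the rest.\<close>

lemma der_eqI:
  assumes "der D" "der E" "D X = E X" "D Y = E Y" "x \<in> L"
  shows "D x = E x"
proof -
  have Y: "D (mono 0 j) = E (mono 0 j)" for j
  proof (induction j)
    case 0
    then show ?case by (simp add: der_one assms)
  next
    case (Suc j)
    have "mono 0 (Suc j) = Y \<odot> mono 0 j" by (simp add: mono_mult)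
    then show ?case
      using derD(3)[OF assms(1), of Y "mono 0 j"] derD(3)[OF assms(2), of Y "mono 0 j"]
      by (simp add: Suc assms Lam_closed del: One_nat_def)
  qed
  have XY: "D (mono i j) = E (mono i j)" for i j
  proof (induction i)
    case (Suc i)
    have "mono (Suc i) j = X \<odot> mono i j" by (simp add: mono_mult)
    then show ?case
      using derD(3)[OF assms(1), of X "mono i j"] derD(3)[OF assms(2), of X "mono i j"]
      by (simp add: Suc assms Lam_closed del: One_nat_def)
  qed (rule Y)
  have *: "F x = (\<Sum>(i, j)\<in>{..<a} \<times> {..<b}. scE (x (i, j)) (F (mono i j)))" if "der F" for F
  proof -
    have "F x = (\<Sum>s\<in>{..<a} \<times> {..<b}. F (case s of (i, j) \<Rightarrow> scE (x (i, j)) (mono i j)))"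
      using der_sum[OF that, of "{..<a} \<times> {..<b}" "\<lambda>(i, j). scE (x (i, j)) (mono i j)"]
        Lam_expand[OF assms(5)] by (auto simp: Lam_closed)
    then show ?thesis using der_scE[OF that] by (auto simp: Lam_closed intro!: sum.cong)
  qed
  show ?thesis using *[OF assms(1)] *[OF assms(2)] by (simp add: XY)
qed

text \<open>The relations \<open>X\<^sup>a = 0\<close> and \<open>Y\<^sup>b = 0\<close> force \<open>D X \<in> X\<Lambda>\<close> and \<open>D Y \<in> Y\<Lambda>\<close>.\<close>

lemma der_power:
  assumes "der D" "x \<in> L" and pw: "\<And>n. pw (Suc n) = x \<odot> pw n" "pw 0 = mono 0 0" "\<And>n. pw n \<in> L"
  shows "D (pw (Suc n)) = scE (of_nat (Suc n)) (pw n \<odot> D x)"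
proof (induction n)
  case 0
  show ?case
    using derD(3)[OF assms(1,2), of "mono 0 0"] derD(1)[OF assms(1,2,2)]
    by (simp add: pw der_one[OF assms(1)] mono_0_lmul lmul_linear scE_linear Lam_closed)
next
  case (Suc n)
  have "D (pw (Suc (Suc n))) = x \<odot> D (pw (Suc n)) + pw (Suc n) \<odot> D x"
    unfolding pw(1)[of "Suc n"] by (rule derD(3)[OF assms(1,2) pw(3)])
  also have "\<dots> = scE (of_nat (Suc n)) (pw (Suc n) \<odot> D x) + pw (Suc n) \<odot> D x"
    unfolding Suc by (simp add: lmul_linear pw(1) lmul_assoc)
  finally show ?case by (simp add: scE_def fun_eq_iff algebra_simps)
qed

lemma der_X_apply:
  assumes "der D"
  shows "D X (0, q) = 0"
proof (cases "q < b")
  case True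
  have "D (mono (Suc (a - 1)) 0) = scE (of_nat (Suc (a - 1))) (mono (a - 1) 0 \<odot> D X)"
    by (rule der_power[OF assms, where pw = "\<lambda>n. mono n 0"]) (auto simp: mono_mult)
  moreover have "mono (Suc (a - 1)) 0 = 0" using a2 by (auto simp: monoL_def fun_eq_iff)
  \<comment> \<open>The scalar \<open>a\<close> is invertible, and multiplication by X^(a-1) moves
    the coefficient of \<open>D X\<close> at \<open>(0, q)\<close> to
    \<open>(a - 1, q)\<close>.\<close>
  ultimately have "scE (of_nat (Suc (a - 1))) (mono (a - 1) 0 \<odot> D X) (a - 1, q) = 0"
    by (simp add: der_0[OF assms])
  then show ?thesis using True a2 by (auto simp: mono_lmul_apply simp del: of_nat_Suc)
next
  case False
  then show ?thesis using derD(1)[OF assms, of X X] by (auto simp: Lam_def monoL_def)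
qed

lemma der_Y_apply:
  assumes "der D"
  shows "D Y (p, 0) = 0"
proof (cases "p < a")
  case True
  have "D (mono 0 (Suc (b - 1))) = scE (of_nat (Suc (b - 1))) (mono 0 (b - 1) \<odot> D Y)"
    by (rule der_power[OF assms, where pw = "\<lambda>n. mono 0 n"]) (auto simp: mono_mult)
  moreover have "mono 0 (Suc (b - 1)) = 0" using b2 by (auto simp: monoL_def fun_eq_iff)
  ultimately have "scE (of_nat (Suc (b - 1))) (mono 0 (b - 1) \<odot> D Y) (p, b - 1) = 0"
    by (simp add: der_0[OF assms])
  then show ?thesis using True b2 by (auto simp: mono_lmul_apply simp del: of_nat_Suc)
next
  case False
  then show ?thesis using derD(1)[OF assms, of Y Y] by (auto simp: Lam_def monoL_def)
qed

text \<open>Converse to the constraints on \<open>D X\<close> and \<open>D Y\<close>: the values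
  \<open>X \<odot> u\<close> and \<open>Y \<odot> v\<close> are realised by this derivation.\<close>

lemma der_Euler:
  assumes "u \<in> L" "v \<in> L"
  shows "der (\<lambda>f. u \<odot> Ex f + v \<odot> Ey f)"
  unfolding der_def
  by (auto simp: Ex_lmul Ey_lmul Ex_linear Ey_linear scE_linear lmul_linear lmul_comm
      lmul_left_comm lmul_assoc algebra_simps Lam_closed)

lemma pbr_skew: "br f g = - br g f"
  by (simp add: pbr_eq lmul_comm)

lemma pbr_linear:
  "br (f + g) h = br f h + br g h" "br (f - g) h = br f h - br g h" "br (- f) h = - br f h"
  "br (scE c f) h = scE c (br f h)" "br h (f + g) = br h f + br h g"
  "br h (f - g) = br h f - br h g" "br h (- f) = - br h f" "br h (scE c f) = scE c (br h f)"
  by (simp_all add: pbr_eq Ex_linear Ey_linear lmul_linear scE_linear)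

lemma pbr_lmul:
  "br (f \<odot> g) h = f \<odot> br g h + g \<odot> br f h" "br h (f \<odot> g) = f \<odot> br h g + g \<odot> br h f"
  by (simp_all add: pbr_eq Ex_lmul Ey_lmul lmul_linear lmul_comm lmul_left_comm lmul_assoc)

text \<open>Since \<open>Ex\<close> and \<open>Ey\<close> commute and obey the Leibniz rule,
  expansion leaves triple products that cancel in pairs.\<close>

lemma pbr_Jacobi: "br f (br g h) + br g (br h f) + br h (br f g) = 0"
  by (simp add: pbr_eq Ex_linear Ey_linear Ex_lmul Ey_lmul Ey_Ex lmul_linear lmul_comm
      lmul_left_comm lmul_assoc)

lemma der_pbr: "der (\<lambda>f. br f g)"
  unfolding der_def by (auto simp: pbr_linear pbr_lmul)

section \<open>Skew-symmetric multiderivations\<close>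

lemma kderD:
  assumes "P \<in> kder a b k"
  shows "\<forall>f. (\<exists>i<k. f i \<notin> L) \<longrightarrow> P f = 0"
    "\<forall>f g. (\<forall>i<k. f i = g i) \<longrightarrow> P f = P g"
    "\<forall>f. P f \<in> L"
    "\<forall>f i x y c. i < k \<and> (\<forall>j<k. f j \<in> L) \<and> x \<in> L \<and> y \<in> L \<longrightarrow>
        P (f(i := x + scE c y)) = P (f(i := x)) + scE c (P (f(i := y)))"
    "\<forall>f i x y. i < k \<and> (\<forall>j<k. f j \<in> L) \<and> x \<in> L \<and> y \<in> L \<longrightarrow>
        P (f(i := x \<odot> y)) = x \<odot> P (f(i := y)) + y \<odot> P (f(i := x))"
    "\<forall>f i j. i < j \<and> j < k \<longrightarrow> P (f(i := f j, j := f i)) = - P f"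
  using assms unfolding kder_def mem_Collect_eq by - (elim conjE, assumption)+

lemma kder_out: "P \<in> kder a b k \<Longrightarrow> i < k \<Longrightarrow> f i \<notin> L \<Longrightarrow> P f = 0"
  using kderD(1) by blast

lemma kder_cong: "P \<in> kder a b k \<Longrightarrow> (\<And>i. i < k \<Longrightarrow> f i = g i) \<Longrightarrow> P f = P g"
  using kderD(2) by blast

lemma kder_Lam: "P \<in> kder a b k \<Longrightarrow> P f \<in> L"
  using kderD(3) by blast

lemma kder_swap: "P \<in> kder a b k \<Longrightarrow> i < j \<Longrightarrow> j < k \<Longrightarrow> P (f(i := f j, j := f i)) = - P f"
  using kderD(6) by blast

lemma kder_der:
  assumes "P \<in> kder a b k" "i < k" "\<And>j. j < k \<Longrightarrow> f j \<in> L"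
  shows "der (\<lambda>x. P (f(i := x)))"
  unfolding der_def
proof (intro conjI ballI allI)
  have f: "\<forall>j<k. f j \<in> L" using assms(3) by blast
  fix x y c assume "x \<in> L" "y \<in> L"
  with f assms(2) have *: "i < k \<and> (\<forall>j<k. f j \<in> L) \<and> x \<in> L \<and> y \<in> L" by blast
  show "P (f(i := x)) \<in> L" by (rule kder_Lam[OF assms(1)])
  show "P (f(i := x + scE c y)) = P (f(i := x)) + scE c (P (f(i := y)))"
    by (rule kderD(4)[OF assms(1), rule_format, OF *])
  show "P (f(i := x \<odot> y)) = x \<odot> P (f(i := y)) + y \<odot> P (f(i := x))"
    by (rule kderD(5)[OF assms(1), rule_format, OF *])
qed

text \<open>A multiderivation is determined by its values on the generators. In \<open>step\<close>,
  the slots from \<open>n\<close> on already hold X or Y, and \<open>der_eqI\<close> frees one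
  further slot at a time.\<close>

lemma kder_eqI:
  assumes P: "P \<in> kder a b k" and R: "R \<in> kder a b k"
    and gen: "\<And>f. (\<And>i. i < k \<Longrightarrow> f i \<in> {X, Y}) \<Longrightarrow> P f = R f"
  shows "P = R"
proof
  fix f
  have step: "P f = R f"
    if "n \<le> k" "\<And>i. i < k \<Longrightarrow> f i \<in> L" "\<And>i. n \<le> i \<Longrightarrow> i < k \<Longrightarrow> f i \<in> {X, Y}" for n f
    using that
  proof (induction n arbitrary: f)
    case 0
    then show ?case using gen by simp
  next
    case (Suc n)
    have "P (f(n := f n)) = R (f(n := f n))"
    proof (rule der_eqI[where D = "\<lambda>x. P (f(n := x))" and E = "\<lambda>x. R (f(n := x))"])
      show "der (\<lambda>x. P (f(n := x)))" "der (\<lambda>x. R (f(n := x)))"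
        using Suc.prems P R by (auto intro!: kder_der)
      have "P (f(n := x)) = R (f(n := x))" if "x \<in> {X, Y}" for x
      proof (rule Suc.IH)
        show "(f(n := x)) i \<in> {X, Y}" if "n \<le> i" "i < k" for i
          using Suc.prems(3)[of i] that \<open>x \<in> {X, Y}\<close> by (cases "i = n") auto
        show "(f(n := x)) i \<in> L" if "i < k" for i
          using Suc.prems(2)[of i] that \<open>x \<in> {X, Y}\<close> by (auto simp: Lam_closed)
      qed (use Suc.prems in simp)
      then show "P (f(n := X)) = R (f(n := X))" "P (f(n := Y)) = R (f(n := Y))" by blast+
      show "f n \<in> L" using Suc.prems by simp
    qed
    then show ?case by simp
  qed
  show "P f = R f"
  \<comment> \<open>If some argument lies outside \<open>L\<close>, both sides vanish by the
    normalisation in \<open>kder\<close>.\<close>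
  proof (cases "\<forall>i<k. f i \<in> L")
    case True
    then show ?thesis using step[of k f] by simp
  next
    case False
    then show ?thesis using kder_out[OF P] kder_out[OF R] by metis
  qed
qed

lemma zero_kder: "0 \<in> kder a b k"
  by (auto simp: kder_def scE_linear lmul_linear Lam_closed)

lemma kder0_iff: "P \<in> kder a b 0 \<longleftrightarrow> (\<exists>g\<in>L. P = (\<lambda>_. g))"
proof
  assume P: "P \<in> kder a b 0"
  \<comment> \<open>With no relevant slot, all argument lists agree, so any of them gives the
    constant.\<close>
  have "P = (\<lambda>_. P undefined)" using kder_cong[OF P] by auto
  then show "\<exists>g\<in>L. P = (\<lambda>_. g)" using kder_Lam[OF P] by blast
qed (auto simp: kder_def)

lemma kder1_der:
  assumes "P \<in> kder a b 1"
  shows "der (\<lambda>x. P (\<lambda>_. x))"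
proof -
  have "P ((\<lambda>_. 0)(0 := x)) = P (\<lambda>_. x)" for x
    by (rule kder_cong[OF assms]) simp
  then show ?thesis using kder_der[OF assms, of 0 "\<lambda>_. 0"] by (simp add: Lam_closed)
qed

lemma kder1_eqI:
  assumes P: "P \<in> kder a b 1" and R: "R \<in> kder a b 1"
    and "P (\<lambda>_. X) = R (\<lambda>_. X)" "P (\<lambda>_. Y) = R (\<lambda>_. Y)"
  shows "P = R"
proof (rule kder_eqI[OF P R])
  fix f :: "nat \<Rightarrow> elt"
  assume f: "\<And>i. i < 1 \<Longrightarrow> f i \<in> {X, Y}"
  have "P f = P (\<lambda>_. f 0)" "R f = R (\<lambda>_. f 0)"
    using kder_cong[OF P, of f "\<lambda>_. f 0"] kder_cong[OF R, of f "\<lambda>_. f 0"] by auto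
  then show "P f = R f" using f[of 0] assms(3,4) by auto
qed

lemma kder1I:
  assumes "der D"
  shows "(\<lambda>f. if f 0 \<in> L then D (f 0) else 0) \<in> kder a b 1"
  using derD[OF assms] by (auto simp: kder_def Lam_closed)

text \<open>\<open>pcons x (\<lambda>_. y)\<close> is the normal form of an argument pair used from
  here on.\<close>

lemma kder2_pair: "P \<in> kder a b 2 \<Longrightarrow> P f = P (pcons (f 0) (\<lambda>_. f 1))"
  by (rule kder_cong) (auto simp: pcons_def less_2_cases_iff)

lemma kder2_skew:
  assumes P: "P \<in> kder a b 2"
  shows "P (pcons x (\<lambda>_. y)) = - P (pcons y (\<lambda>_. x))"
proof -
  let ?f = "pcons y (\<lambda>_. x)"
  have "P (?f(0 := ?f 1, 1 := ?f 0)) = - P ?f" by (rule kder_swap[OF P]) auto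
  moreover have "P (?f(0 := ?f 1, 1 := ?f 0)) = P (pcons x (\<lambda>_. y))"
    by (rule kder_cong[OF P]) (auto simp: pcons_def less_2_cases_iff)
  ultimately show ?thesis by simp
qed

lemma elt_eq_minus: "x = - x \<Longrightarrow> x = 0" for x :: elt
  by (auto simp: fun_eq_iff)

text \<open>On pairs of generators, skew-symmetry kills the diagonal and gives \<open>(Y, X)\<close>
  from \<open>(X, Y)\<close>.\<close>

lemma kder2_eqI:
  assumes P: "P \<in> kder a b 2" and R: "R \<in> kder a b 2"
    and XY: "P (pcons X (\<lambda>_. Y)) = R (pcons X (\<lambda>_. Y))"
  shows "P = R"
proof (rule kder_eqI[OF P R])
  fix f :: "nat \<Rightarrow> elt"
  assume f: "\<And>i. i < 2 \<Longrightarrow> f i \<in> {X, Y}"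
  have diag: "P (pcons x (\<lambda>_. x)) = 0" "R (pcons x (\<lambda>_. x)) = 0" for x
    using kder2_skew[OF P, of x x] kder2_skew[OF R, of x x] elt_eq_minus by blast+
  have "P (pcons Y (\<lambda>_. X)) = R (pcons Y (\<lambda>_. X))"
    using XY kder2_skew[OF P, of Y X] kder2_skew[OF R, of Y X] by simp
  then have "P (pcons x (\<lambda>_. y)) = R (pcons x (\<lambda>_. y))" if "x \<in> {X, Y}" "y \<in> {X, Y}" for x y
    using that XY diag by (auto simp del: One_nat_def)
  from this[OF f f] show "P f = R f"
    by (simp add: kder2_pair[OF P, of f] kder2_pair[OF R, of f])
qed

text \<open>Skew-symmetry transports linearity and the Leibniz rule from the first slot to the
  second.\<close>

lemma kder2I:
  assumes D: "\<And>x. x \<in> L \<Longrightarrow> der (\<lambda>y. B y x)" and skew: "\<And>x y. B x y = - B y x"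
  shows "(\<lambda>f. if f 0 \<in> L \<and> f 1 \<in> L then B (f 0) (f 1) else 0) \<in> kder a b 2"
proof -
  have add: "B (x + scE c y) z = B x z + scE c (B y z)"
    and mult: "B (x \<odot> y) z = x \<odot> B y z + y \<odot> B x z" and closed: "B x z \<in> L"
    if "x \<in> L" "y \<in> L" "z \<in> L" for x y z c
    using derD[OF D[OF that(3)] that(1,2)] by auto
  have add': "B z (x + scE c y) = B z x + scE c (B z y)"
    and mult': "B z (x \<odot> y) = x \<odot> B z y + y \<odot> B z x"
    if "x \<in> L" "y \<in> L" "z \<in> L" for x y z c
    using add[OF that, of c] mult[OF that] skew[of z]
    by (simp_all add: scE_linear lmul_linear)
  define P where "P = (\<lambda>f :: nat \<Rightarrow> elt. if f 0 \<in> L \<and> f 1 \<in> L then B (f 0) (f 1) else 0)"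
  have "P \<in> kder a b 2"
    unfolding kder_def mem_Collect_eq
  proof (intro conjI allI impI)
    fix f :: "nat \<Rightarrow> elt" and i j :: nat
    assume "i < j \<and> j < 2"
    then have "i = 0" "j = 1" by auto
    then show "P (f(i := f j, j := f i)) = - P f"
      using skew[of "f 1" "f 0"] by (simp add: P_def)
  next
    fix f :: "nat \<Rightarrow> elt" and i :: nat and x y c
    assume "i < 2 \<and> (\<forall>j<2. f j \<in> L) \<and> x \<in> L \<and> y \<in> L"
    then have "i = 0 \<or> i = 1" and L: "f 0 \<in> L" "f 1 \<in> L" "f (Suc 0) \<in> L" "x \<in> L" "y \<in> L"
      by auto
    then show "P (f(i := x + scE c y)) = P (f(i := x)) + scE c (P (f(i := y)))"
      by (elim disjE) (simp_all add: P_def L Lam_closed add add')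
  next
    fix f :: "nat \<Rightarrow> elt" and i :: nat and x y
    assume "i < 2 \<and> (\<forall>j<2. f j \<in> L) \<and> x \<in> L \<and> y \<in> L"
    then have "i = 0 \<or> i = 1" and L: "f 0 \<in> L" "f 1 \<in> L" "f (Suc 0) \<in> L" "x \<in> L" "y \<in> L"
      by auto
    then show "P (f(i := x \<odot> y)) = x \<odot> P (f(i := y)) + y \<odot> P (f(i := x))"
      by (elim disjE) (simp_all add: P_def L Lam_closed mult mult')
  next
    fix f :: "nat \<Rightarrow> elt"
    show "P f \<in> L" using closed[of "f 0" "f 0" "f 1"] by (simp add: P_def Lam_closed)
  next
    fix f :: "nat \<Rightarrow> elt" assume "\<exists>i<2::nat. f i \<notin> L"
    then show "P f = 0" by (auto simp: P_def less_2_cases_iff)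
  next
    fix f g :: "nat \<Rightarrow> elt" assume "\<forall>i<2::nat. f i = g i"
    then show "P f = P g" by (simp add: P_def)
  qed
  then show ?thesis by (simp add: P_def)
qed

text \<open>Pigeonhole: among three arguments taken from two generators two coincide, and swapping
  them changes the sign.\<close>

lemma kder_ge3:
  assumes "3 \<le> k" "P \<in> kder a b k"
  shows "P = 0"
proof (rule kder_eqI[OF assms(2) zero_kder])
  fix f :: "nat \<Rightarrow> elt"
  assume f: "\<And>i. i < k \<Longrightarrow> f i \<in> {X, Y}"
  have "f 0 = f 1 \<or> f 0 = f 2 \<or> f 1 = f 2"
    using f[of 0] f[of 1] f[of 2] assms(1) by auto
  then have "\<exists>i j. i < j \<and> j \<le> (2::nat) \<and> f i = f j"
    by (elim disjE) (rule exI[of _ 0] exI[of _ 1], rule exI[of _ 1] exI[of _ 2], simp)+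
  then obtain i j where "i < j" "j < k" "f i = f j" using assms(1) by auto
  moreover from this(3) have "f(i := f j, j := f i) = f" by auto
  ultimately show "P f = 0 f" using kder_swap[OF assms(2), of i j f] elt_eq_minus by auto
qed

section \<open>The Poisson coboundary in low degrees\<close>

lemma delta_0: "delta a b 0 (\<lambda>_. g) = (\<lambda>f. if f 0 \<in> L then br (f 0) g else 0)"
  by (rule ext) (simp add: delta_def scE_linear)

lemma delta_1:
  assumes P: "P \<in> kder a b 1"
  shows "delta a b 1 P = (\<lambda>f. if f 0 \<in> L \<and> f 1 \<in> L then br (f 0) (P (\<lambda>_. f 1))
    - br (f 1) (P (\<lambda>_. f 0)) - P (\<lambda>_. br (f 0) (f 1)) else 0)"
proof
  fix f
  have "P (del 0 f) = P (\<lambda>_. f 1)" "P (del 1 f) = P (\<lambda>_. f 0)"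
    "P (pcons (br (f 0) (f 1)) h) = P (\<lambda>_. br (f 0) (f 1))" for h
    by (auto intro!: kder_cong[OF P] simp: del_def pcons_def)
  then show "delta a b 1 P f = (if f 0 \<in> L \<and> f 1 \<in> L then br (f 0) (P (\<lambda>_. f 1))
    - br (f 1) (P (\<lambda>_. f 0)) - P (\<lambda>_. br (f 0) (f 1)) else 0)"
    by (auto simp: delta_def scE_linear le_Suc_eq)
qed

text \<open>The Poisson bivector, cut off outside \<open>L\<close> as \<open>kder\<close> demands.
  It represents the generator of HP^2.\<close>

definition brP :: "(nat \<Rightarrow> elt) \<Rightarrow> elt" where
  "brP = (\<lambda>f. if f 0 \<in> L \<and> f 1 \<in> L then br (f 0) (f 1) else 0)"

lemma brP_kder: "brP \<in> kder a b 2"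
  unfolding brP_def by (rule kder2I[of br, OF der_pbr pbr_skew])

text \<open>The coboundary of the bracket is twice its Jacobi sum.\<close>

lemma delta_brP: "delta a b 2 brP = 0"
proof
  fix f :: "nat \<Rightarrow> elt"
  let ?x = "f 0" and ?y = "f 1" and ?z = "f 2"
  show "delta a b 2 brP f = 0 f"
  proof (cases "\<forall>i\<le>2. f i \<in> L")
    case True
    then have L: "?x \<in> L" "?y \<in> L" "?z \<in> L" "f (Suc 0) \<in> L" by auto
    have "delta a b 2 brP f = br ?x (br ?y ?z) - br ?y (br ?x ?z) + br ?z (br ?x ?y)
        + (br (br ?x ?z) ?y - br (br ?x ?y) ?z - br (br ?y ?z) ?x)"
      using True L
      by (simp add: delta_def brP_def scE_linear numeral_2_eq_2 del_def pcons_def Lam_closed)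
    also have "\<dots> = scE 2 (br ?x (br ?y ?z) + br ?y (br ?z ?x) + br ?z (br ?x ?y))"
      by (simp only: pbr_skew[of "br ?x ?z" ?y] pbr_skew[of "br ?y ?z" ?x]
          pbr_skew[of "br ?x ?y" ?z] pbr_skew[of ?z ?x] pbr_linear) (simp add: fun_eq_iff)
    finally show ?thesis by (simp add: pbr_Jacobi scE_linear)
  qed (auto simp: delta_def)
qed

lemma delta_0_kder:
  assumes "P \<in> kder a b 0"
  shows "delta a b 0 P \<in> kder a b 1"
  using assms kder1I[OF der_pbr] by (auto simp: kder0_iff delta_0)

text \<open>The coboundary measures how far \<open>P\<close> is from being a derivation of the
  bracket; skewness is clear, so one slot has to be checked.\<close>

lemma delta_1_kder:
  assumes P: "P \<in> kder a b 1"
  shows "delta a b 1 P \<in> kder a b 2"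
  unfolding delta_1[OF P]
proof (rule kder2I)
  note D = kder1_der[OF P]
  have minus: "P (\<lambda>_. - x) = - P (\<lambda>_. x)" if "x \<in> L" for x
    using der_scE[OF D that, of "-1"] by (simp add: scE_linear)
  show "br x (P (\<lambda>_. y)) - br y (P (\<lambda>_. x)) - P (\<lambda>_. br x y) =
       - (br y (P (\<lambda>_. x)) - br x (P (\<lambda>_. y)) - P (\<lambda>_. br y x))" for x y
    using minus[of "br y x"] by (simp add: pbr_skew[of x y] Lam_closed)
  show "der (\<lambda>y. br y (P (\<lambda>_. x)) - br x (P (\<lambda>_. y)) - P (\<lambda>_. br y x))" if x: "x \<in> L" for x
    unfolding der_def
  proof (intro conjI ballI allI)
    fix y z c assume yz: "y \<in> L" "z \<in> L"
    have [simp]: "br y x \<in> L" "br z x \<in> L" by (rule Lam_closed)+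
    show "br y (P (\<lambda>_. x)) - br x (P (\<lambda>_. y)) - P (\<lambda>_. br y x) \<in> L"
      by (intro Lam_closed kder_Lam[OF P])
    show "br (y + scE c z) (P (\<lambda>_. x)) - br x (P (\<lambda>_. y + scE c z)) - P (\<lambda>_. br (y + scE c z) x)
        = br y (P (\<lambda>_. x)) - br x (P (\<lambda>_. y)) - P (\<lambda>_. br y x)
          + scE c (br z (P (\<lambda>_. x)) - br x (P (\<lambda>_. z)) - P (\<lambda>_. br z x))"
      by (simp add: derD(2)[OF D] yz pbr_linear scE_linear)
    \<comment> \<open>Its expansion yields mixed products of a bracket with a value of
      \<open>P\<close>. These cancel against those from
      \<open>br x (P (\<lambda>_. y \<odot> z))\<close> because the bracket is skew.\<close>
    have "P (\<lambda>_. br (y \<odot> z) x) = P (\<lambda>_. y \<odot> br z x) + P (\<lambda>_. z \<odot> br y x)"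
      by (simp add: pbr_lmul der_add[OF D] Lam_closed)
    then show "br (y \<odot> z) (P (\<lambda>_. x)) - br x (P (\<lambda>_. y \<odot> z)) - P (\<lambda>_. br (y \<odot> z) x)
        = y \<odot> (br z (P (\<lambda>_. x)) - br x (P (\<lambda>_. z)) - P (\<lambda>_. br z x))
          + z \<odot> (br y (P (\<lambda>_. x)) - br x (P (\<lambda>_. y)) - P (\<lambda>_. br y x))"
      by (simp add: derD(3)[OF D] yz pbr_lmul pbr_linear lmul_linear lmul_comm[of "br _ _"]
          pbr_skew[of x y] pbr_skew[of x z])
  qed
qed

section \<open>Poisson cocycles and coboundaries in terms of coefficients\<close>

declare One_nat_def [simp del]

lemma pcons_simps [simp]: "pcons x f 0 = x" "pcons x f 1 = f 0"
  by (simp_all add: pcons_def One_nat_def)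

lemma HPB_1: "HPB a b 1 = delta a b 0 ` kder a b 0"
  and HPB_2: "HPB a b 2 = delta a b 1 ` kder a b 1"
  by (simp_all add: HPB_def One_nat_def)

lemma LamD: "f \<in> L \<Longrightarrow> \<not> (p < a \<and> q < b) \<Longrightarrow> f (p, q) = 0"
  by (auto simp: Lam_def)

lemma X_lmul_apply: "(X \<odot> f) (p, q) = (if 0 < p \<and> p < a \<and> q < b then f (p - 1, q) else 0)"
  by (auto simp: mono_lmul_apply)

lemma Y_lmul_apply: "(Y \<odot> f) (p, q) = (if 0 < q \<and> p < a \<and> q < b then f (p, q - 1) else 0)"
  by (auto simp: mono_lmul_apply)

text \<open>The Casimirs. Bracketing with X forces \<open>q * g (p, q) = 0\<close> unless
  \<open>p = a - 1\<close>, bracketing with Y forces \<open>p * g (p, q) = 0\<close> unless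
  \<open>q = b - 1\<close>.\<close>

lemma HPZ_0_iff:
  "P \<in> HPZ a b 0 \<longleftrightarrow>
    (\<exists>g\<in>L. P = (\<lambda>_. g) \<and> (\<forall>p q. (p, q) \<noteq> (0, 0) \<longrightarrow> (p, q) \<noteq> (a - 1, b - 1) \<longrightarrow> g (p, q) = 0))"
proof
  assume P: "P \<in> HPZ a b 0"
  then obtain g where g: "g \<in> L" and Pg: "P = (\<lambda>_. g)"
    by (auto simp: HPZ_def kder0_iff)
  have d: "delta a b 0 P (\<lambda>_. x) (p, q) = 0" for x p q
    using P by (simp add: HPZ_def)
  have X: "of_nat q * g (p, q) = 0" if "p + 1 < a" "q < b" for p q
    using d[of X "p + 1" q] that
    by (simp add: Pg delta_0 pbr_X X_lmul_apply Ey_def Lam_closed)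
  have Y: "of_nat p * g (p, q) = 0" if "p < a" "q + 1 < b" for p q
    using d[of Y p "q + 1"] that
    by (simp add: Pg delta_0 pbr_Y Y_lmul_apply Ex_def Lam_closed)
  have "g (p, q) = 0" if "(p, q) \<noteq> (0, 0)" "(p, q) \<noteq> (a - 1, b - 1)" for p q
  proof (cases "p < a \<and> q < b")
    case True
    with that consider "p + 1 < a" "q \<noteq> 0" | "q + 1 < b" "p \<noteq> 0" | "p + 1 < a" "q + 1 = b" | "p = 0"
      by force
    then show ?thesis
      using X[of p q] Y[of p q] True that a2 b2 by cases auto
  qed (rule LamD[OF g])
  with g Pg show "\<exists>g\<in>L. P = (\<lambda>_. g) \<and>
      (\<forall>p q. (p, q) \<noteq> (0, 0) \<longrightarrow> (p, q) \<noteq> (a - 1, b - 1) \<longrightarrow> g (p, q) = 0)" by blast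
next
  assume "\<exists>g\<in>L. P = (\<lambda>_. g) \<and>
      (\<forall>p q. (p, q) \<noteq> (0, 0) \<longrightarrow> (p, q) \<noteq> (a - 1, b - 1) \<longrightarrow> g (p, q) = 0)"
  then obtain g where g: "g \<in> L" and Pg: "P = (\<lambda>_. g)"
    and supp: "\<And>p q. (p, q) \<noteq> (0, 0) \<Longrightarrow> (p, q) \<noteq> (a - 1, b - 1) \<Longrightarrow> g (p, q) = 0" by blast
  have geq: "g = scE (g (0, 0)) (mono 0 0) + scE (g (a - 1, b - 1)) (mono (a - 1) (b - 1))"
  proof
    fix x :: "nat \<times> nat"
    show "g x = (scE (g (0, 0)) (mono 0 0) + scE (g (a - 1, b - 1)) (mono (a - 1) (b - 1))) x"
      using supp[of "fst x" "snd x"] a2 b2 by (cases x) (auto simp: monoL_def)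
  qed
  \<comment> \<open>The socle element annihilates everything without constant term, in particular
    all values of \<open>Ex\<close> and \<open>Ey\<close>.\<close>
  have top: "mono (a - 1) (b - 1) \<odot> f = 0" if "f (0, 0) = 0" for f
    using that by (auto simp: fun_eq_iff mono_lmul_apply)
  have "br f (mono 0 0) = 0" for f
    by (simp add: pbr_eq Euler_mono lmul_linear scE_linear)
  moreover have "br f (mono (a - 1) (b - 1)) = 0" for f
  proof -
    have "mono (a - 1) (b - 1) \<odot> Ex f = 0" "mono (a - 1) (b - 1) \<odot> Ey f = 0"
      by (rule top, simp add: Ex_def Ey_def)+
    then show ?thesis
      by (simp add: pbr_eq Euler_mono lmul_linear scE_linear lmul_comm[of _ "mono (a - 1) (b - 1)"])
  qed
  ultimately have "br f g = 0" for f
    by (subst geq) (simp only: pbr_linear scE_linear add_0_left)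
  with g show "P \<in> HPZ a b 0"
    by (auto simp: HPZ_def kder0_iff Pg delta_0 fun_eq_iff)
qed

lemma delta_1_XY:
  assumes P: "P \<in> kder a b 1"
  shows "delta a b 1 P (pcons X (\<lambda>_. Y)) = br X (P (\<lambda>_. Y)) - br Y (P (\<lambda>_. X))
    - (X \<odot> P (\<lambda>_. Y) + Y \<odot> P (\<lambda>_. X))"
proof -
  have "br X Y = X \<odot> Y" by (simp add: pbr_X Euler_mono scE_linear)
  then show ?thesis
    using derD(3)[OF kder1_der[OF P], of X Y]
    by (simp add: delta_1[OF P] Lam_closed)
qed

text \<open>The Koszul differential in multidegree \<open>(p, q)\<close>. The term
  \<open>P {X, Y}\<close> lowers the Euler weights \<open>p + 1\<close> and \<open>q + 1\<close> to
  \<open>p\<close> and \<open>q\<close>.\<close>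

lemma delta_1_XY_apply:
  assumes P: "P \<in> kder a b 1" and "p + 1 < a" "q + 1 < b"
  shows "delta a b 1 P (pcons X (\<lambda>_. Y)) (p + 1, q + 1)
    = of_nat q * P (\<lambda>_. Y) (p, q + 1) + of_nat p * P (\<lambda>_. X) (p + 1, q)"
  unfolding delta_1_XY[OF P]
  using assms(2,3) by (simp add: pbr_X pbr_Y X_lmul_apply Y_lmul_apply Ex_def Ey_def algebra_simps)

lemma kder1_value_zero:
  assumes "P \<in> kder a b 1"
  shows "P (\<lambda>_. X) (0, q) = 0" "P (\<lambda>_. Y) (p, 0) = 0"
  using der_X_apply[OF kder1_der[OF assms]] der_Y_apply[OF kder1_der[OF assms]] by auto

text \<open>Freezing either slot leaves a derivation, so the value on \<open>(X, Y)\<close> is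
  divisible by both X and Y.\<close>

lemma kder2_value_zero:
  assumes P: "P \<in> kder a b 2"
  shows "P (pcons X (\<lambda>_. Y)) (0, q) = 0" "P (pcons X (\<lambda>_. Y)) (p, 0) = 0"
proof -
  let ?f = "pcons X (\<lambda>_. Y)"
  have L: "?f j \<in> L" for j by (auto simp: pcons_def Lam_closed split: nat.split)
  have "?f(0 := X) = ?f" "?f(1 := Y) = ?f" by (auto simp: fun_upd_idem)
  then show "P ?f (0, q) = 0" "P ?f (p, 0) = 0"
    using der_X_apply[OF kder_der[where f = ?f, OF P _ L, of 0]]
      der_Y_apply[OF kder_der[where f = ?f, OF P _ L, of 1]]
    by auto
qed

text \<open>Koszul exactness away from multidegree \<open>(0, 0)\<close>. A potential
  \<open>g\<close> must satisfy \<open>q * g (p, q) = u (p + 1, q)\<close> and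
  \<open>p * g (p, q) = - v (p, q + 1)\<close>; the cocycle condition makes the two equations
  compatible.\<close>

lemma HPB_1_iff:
  assumes "P \<in> HPZ a b 1"
  shows "P \<in> HPB a b 1 \<longleftrightarrow> P (\<lambda>_. X) (1, 0) = 0 \<and> P (\<lambda>_. Y) (0, 1) = 0"
proof
  assume "P \<in> HPB a b 1"
  then obtain g where "P = (\<lambda>f. if f 0 \<in> L then br (f 0) g else 0)"
    by (auto simp: HPB_1 kder0_iff delta_0)
  then show "P (\<lambda>_. X) (1, 0) = 0 \<and> P (\<lambda>_. Y) (0, 1) = 0"
    using a2 b2 by (simp add: pbr_X pbr_Y X_lmul_apply Y_lmul_apply Ex_def Ey_def Lam_closed)
next
  assume z: "P (\<lambda>_. X) (1, 0) = 0 \<and> P (\<lambda>_. Y) (0, 1) = 0"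
  define u v where "u = P (\<lambda>_. X)" and "v = P (\<lambda>_. Y)"
  have P: "P \<in> kder a b 1" and d: "delta a b 1 P = 0" using assms by (auto simp: HPZ_def)
  have uv: "u \<in> L" "v \<in> L" using kder_Lam[OF P] by (auto simp: u_def v_def)
  have cyc: "of_nat q * v (p, q + 1) + of_nat p * u (p + 1, q) = 0" if "p + 1 < a" "q + 1 < b" for p q
    using delta_1_XY_apply[OF P that] by (simp add: d u_def v_def)
  have u0: "u (p + 1, 0) = 0" if "p + 1 < a" for p
    using cyc[OF that, of 0] z b2 by (cases "p = 0") (auto simp: u_def)
  have v0: "v (0, q + 1) = 0" if "q + 1 < b" for q
    using cyc[OF _ that, of 0] z a2 by (cases "q = 0") (auto simp: v_def)
  \<comment> \<open>Divide by \<open>q\<close> where the first equation determines \<open>g\<close>,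
    otherwise by \<open>p\<close>. The default 0 inside the rectangle is left exactly at
    \<open>(0, 0)\<close> and \<open>(a - 1, b - 1)\<close>, the positions of the Casimirs.\<close>
  define g :: elt where "g = (\<lambda>(p, q). if p < a \<and> q < b then
      if p + 1 < a \<and> q \<noteq> 0 then u (p + 1, q) / of_nat q
      else if q + 1 < b \<and> p \<noteq> 0 then - v (p, q + 1) / of_nat p else 0 else 0)"
  have g: "g \<in> L" by (auto simp: g_def Lam_def)
  have gu: "of_nat q * g (p, q) = u (p + 1, q)" if "p + 1 < a" "q < b" for p q
    using that u0[of p] by (auto simp: g_def)
  have gv: "of_nat p * g (p, q) = - v (p, q + 1)" if "p < a" "q + 1 < b" for p q
  proof (cases "p + 1 < a \<and> q \<noteq> 0")
    case True
    have "v (p, q + 1) = - (of_nat p * u (p + 1, q)) / of_nat q"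
      using cyc[of p q] True that by (simp add: field_simps add_eq_0_iff)
    then show ?thesis using True that by (simp add: g_def)
  next
    case False
    then show ?thesis using that v0[of q] by (auto simp: g_def)
  qed
  have "P = delta a b 0 (\<lambda>_. g)"
  proof (rule kder1_eqI[OF P])
    show "delta a b 0 (\<lambda>_. g) \<in> kder a b 1" using g by (auto intro!: delta_0_kder simp: kder0_iff)
    have "u (p, q) = (X \<odot> Ey g) (p, q)" for p q
      using gu[of "p - 1" q] kder1_value_zero(1)[OF P, of q] LamD[OF uv(1), of p q]
      by (cases "p = 0") (auto simp: X_lmul_apply Ey_def u_def)
    then show "P (\<lambda>_. X) = delta a b 0 (\<lambda>_. g) (\<lambda>_. X)"
      by (auto simp: delta_0 Lam_closed pbr_X u_def)
    have "v (p, q) = (- (Y \<odot> Ex g)) (p, q)" for p q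
      using gv[of p "q - 1"] kder1_value_zero(2)[OF P, of p] LamD[OF uv(2), of p q]
      by (cases "q = 0") (auto simp: Y_lmul_apply Ex_def v_def)
    then show "P (\<lambda>_. Y) = delta a b 0 (\<lambda>_. g) (\<lambda>_. Y)"
      by (auto simp: delta_0 Lam_closed pbr_Y v_def)
  qed
  with g show "P \<in> HPB a b 1" unfolding HPB_1 by (metis image_eqI kder0_iff)
qed

text \<open>Representatives of HP^1. The scalars are written as constant elements to match
  \<open>der_Euler\<close>.\<close>

definition eulerP :: "complex \<Rightarrow> complex \<Rightarrow> (nat \<Rightarrow> elt) \<Rightarrow> elt" where
  "eulerP \<alpha> \<beta> = (\<lambda>f. if f 0 \<in> L then scE \<alpha> (mono 0 0) \<odot> Ex (f 0) + scE \<beta> (mono 0 0) \<odot> Ey (f 0) else 0)"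

lemma eulerP_values:
  "eulerP \<alpha> \<beta> (\<lambda>_. X) = scE \<alpha> X" "eulerP \<alpha> \<beta> (\<lambda>_. Y) = scE \<beta> Y"
  by (simp_all add: eulerP_def Lam_closed Euler_mono scE_linear lmul_linear mono_mult)

lemma eulerP_cocycle: "eulerP \<alpha> \<beta> \<in> HPZ a b 1"
proof -
  have P: "eulerP \<alpha> \<beta> \<in> kder a b 1"
    unfolding eulerP_def by (intro kder1I der_Euler Lam_closed)
  have "delta a b 1 (eulerP \<alpha> \<beta>) = 0"
  proof (rule kder2_eqI[OF delta_1_kder[OF P] zero_kder])
    show "delta a b 1 (eulerP \<alpha> \<beta>) (pcons X (\<lambda>_. Y)) = 0 (pcons X (\<lambda>_. Y))"
      by (simp add: delta_1_XY[OF P] eulerP_values pbr_X pbr_Y Ex_linear Ey_linear Euler_mono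
          scE_linear lmul_linear)
  qed
  with P show ?thesis by (simp add: HPZ_def)
qed

text \<open>The differential into position \<open>(i + 1, j + 1)\<close> has coefficients
  \<open>i\<close> and \<open>j\<close>, so only \<open>(1, 1)\<close> is obstructed.\<close>

lemma HPB_2_iff:
  assumes P: "P \<in> kder a b 2"
  shows "P \<in> HPB a b 2 \<longleftrightarrow> P (pcons X (\<lambda>_. Y)) (1, 1) = 0"
proof
  assume "P \<in> HPB a b 2"
  then obtain Q where "Q \<in> kder a b 1" "P = delta a b 1 Q" by (auto simp: HPB_2)
  then show "P (pcons X (\<lambda>_. Y)) (1, 1) = 0"
    using delta_1_XY_apply[of Q 0 0] a2 b2 by simp
next
  define w where "w = P (pcons X (\<lambda>_. Y))"
  assume "P (pcons X (\<lambda>_. Y)) (1, 1) = 0"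
  then have w11: "w (1, 1) = 0" by (simp add: w_def)
  have w: "w \<in> L" using kder_Lam[OF P] by (simp add: w_def)
  \<comment> \<open>The coefficient of \<open>w\<close> at \<open>(i + 1, j + 1)\<close> is absorbed
    by \<open>Q X\<close> when \<open>i > 0\<close>, and by \<open>Q Y\<close> when
    \<open>i = 0\<close> and \<open>j > 0\<close>.\<close>
  define u v :: elt
    where "u = (\<lambda>(i, j). if 0 < i then w (i + 1, j + 1) / of_nat i else 0)"
      and "v = (\<lambda>(i, j). if i = 0 \<and> 0 < j then w (1, j + 1) / of_nat j else 0)"
  have uv: "u \<in> L" "v \<in> L" using w a2 by (auto simp: Lam_def u_def v_def)
  define Q where "Q = (\<lambda>f :: nat \<Rightarrow> elt. if f 0 \<in> L then u \<odot> Ex (f 0) + v \<odot> Ey (f 0) else 0)"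
  have Q: "Q \<in> kder a b 1" unfolding Q_def by (rule kder1I[OF der_Euler[OF uv]])
  have QX: "Q (\<lambda>_. X) = X \<odot> u" and QY: "Q (\<lambda>_. Y) = Y \<odot> v"
    by (simp_all add: Q_def Lam_closed Euler_mono scE_linear lmul_linear lmul_comm)
  have dQ: "delta a b 1 Q \<in> kder a b 2" by (rule delta_1_kder[OF Q])
  have "w (p, q) = delta a b 1 Q (pcons X (\<lambda>_. Y)) (p, q)" for p q
  proof (cases "0 < p \<and> p < a \<and> 0 < q \<and> q < b")
    case True
    then obtain i j where ij: "p = i + 1" "q = j + 1" by (metis Suc_eq_plus1 gr0_implies_Suc)
    then have "i + 1 < a" "j + 1 < b" using True by auto
    from delta_1_XY_apply[OF Q this] this show ?thesis
      using w11
      by (cases "i = 0"; cases "j = 0") (auto simp: ij QX QY X_lmul_apply Y_lmul_apply u_def v_def)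
  next
    case False
    then show ?thesis
      using kder2_value_zero[OF P] kder2_value_zero[OF dQ] LamD[OF kder_Lam[OF dQ]] LamD[OF w]
      by (auto simp: w_def)
  qed
  then have "P = delta a b 1 Q" by (intro kder2_eqI[OF P dQ]) (auto simp: w_def)
  with Q show "P \<in> HPB a b 2" by (auto simp: HPB_2)
qed

lemma scE_sum: "scE c (sum g S) = (\<Sum>s\<in>S. scE c (g s))"
  by (simp add: fun_eq_iff sum_apply sum_distrib_left)

lemma scE_scE: "scE c (scE d f) = scE d (scE c f)"
  by (simp add: fun_eq_iff)

lemma kder_scC:
  assumes "P \<in> kder a b k"
  shows "scC c P \<in> kder a b k"
  unfolding kder_def mem_Collect_eq
proof (intro conjI)
  note D = kderD[OF assms]
  show "\<forall>f. (\<exists>i<k. f i \<notin> L) \<longrightarrow> scC c P f = 0"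
    using D(1) by (simp add: scC_def scE_linear)
  show "\<forall>f g. (\<forall>i<k. f i = g i) \<longrightarrow> scC c P f = scC c P g"
    using D(2) unfolding scC_def by metis
  show "\<forall>f. scC c P f \<in> L"
    using D(3) by (simp add: scC_def Lam_closed)
  show "\<forall>f i x y ca. i < k \<and> (\<forall>j<k. f j \<in> L) \<and> x \<in> L \<and> y \<in> L \<longrightarrow>
      scC c P (f(i := x + scE ca y)) = scC c P (f(i := x)) + scE ca (scC c P (f(i := y)))"
    using D(4) by (simp add: scC_def scE_linear scE_scE[of c])
  show "\<forall>f i x y. i < k \<and> (\<forall>j<k. f j \<in> L) \<and> x \<in> L \<and> y \<in> L \<longrightarrow>
      scC c P (f(i := x \<odot> y)) = x \<odot> scC c P (f(i := y)) + y \<odot> scC c P (f(i := x))"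
    using D(5) by (simp add: scC_def scE_linear lmul_linear)
  show "\<forall>f i j. i < j \<and> j < k \<longrightarrow> scC c P (f(i := f j, j := f i)) = - scC c P f"
    using D(6) by (simp add: scC_def scE_linear)
qed

lemma delta_scC: "delta a b k (scC c P) = scC c (delta a b k P)"
  by (rule ext) (simp add: delta_def scC_def scE_linear scE_sum pbr_linear scE_scE[of c]
      if_distrib[of "scE c"] cong: if_cong)

lemma delta_zero: "delta a b k 0 = 0"
  using delta_scC[of k 0 0] by (simp add: scC_def scE_linear zero_fun_def[symmetric])

section \<open>The homology complex\<close>

declare of_nat_diff [simp del]

text \<open>Multiplication by X^(a-1) pushes every column but \<open>p = 0\<close> out of the
  algebra. With its Y counterpart this turns \<open>Rel\<close> into support conditions.\<close>

lemma X_top_image: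
  "(\<exists>m\<in>L. f = mono (a - 1) 0 \<odot> m) \<longleftrightarrow> f \<in> L \<and> (\<forall>p q. p \<noteq> a - 1 \<longrightarrow> f (p, q) = 0)"
proof
  assume "\<exists>m\<in>L. f = mono (a - 1) 0 \<odot> m"
  then show "f \<in> L \<and> (\<forall>p q. p \<noteq> a - 1 \<longrightarrow> f (p, q) = 0)"
    by (auto simp: mono_lmul_apply Lam_closed)
next
  assume f: "f \<in> L \<and> (\<forall>p q. p \<noteq> a - 1 \<longrightarrow> f (p, q) = 0)"
  define m :: elt where "m = (\<lambda>(p, q). if p = 0 then f (a - 1, q) else 0)"
  have "m \<in> L" using f a2 by (auto simp: m_def Lam_def)
  moreover have "f (p, q) = (mono (a - 1) 0 \<odot> m) (p, q)" for p q
    using f by (cases "p = a - 1") (auto simp: mono_lmul_apply m_def LamD)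
  ultimately show "\<exists>m\<in>L. f = mono (a - 1) 0 \<odot> m" by (intro bexI[of _ m]) auto
qed

lemma Y_top_image:
  "(\<exists>m\<in>L. f = mono 0 (b - 1) \<odot> m) \<longleftrightarrow> f \<in> L \<and> (\<forall>p q. q \<noteq> b - 1 \<longrightarrow> f (p, q) = 0)"
proof
  assume "\<exists>m\<in>L. f = mono 0 (b - 1) \<odot> m"
  then show "f \<in> L \<and> (\<forall>p q. q \<noteq> b - 1 \<longrightarrow> f (p, q) = 0)"
    by (auto simp: mono_lmul_apply Lam_closed)
next
  assume f: "f \<in> L \<and> (\<forall>p q. q \<noteq> b - 1 \<longrightarrow> f (p, q) = 0)"
  define m :: elt where "m = (\<lambda>(p, q). if q = 0 then f (p, b - 1) else 0)"
  have "m \<in> L" using f b2 by (auto simp: m_def Lam_def)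
  moreover have "f (p, q) = (mono 0 (b - 1) \<odot> m) (p, q)" for p q
    using f by (cases "q = b - 1") (auto simp: mono_lmul_apply m_def LamD)
  ultimately show "\<exists>m\<in>L. f = mono 0 (b - 1) \<odot> m" by (intro bexI[of _ m]) auto
qed

lemma Chains_0: "c \<in> Chains a b 0 \<longleftrightarrow> c 0 \<in> L \<and> (\<forall>i>0. c i = 0)"
  by (auto simp: Chains_def)

lemma Chains_1: "c \<in> Chains a b 1 \<longleftrightarrow> c 0 \<in> L \<and> c 1 \<in> L \<and> (\<forall>i>1. c i = 0)"
  by (auto simp: Chains_def One_nat_def less_Suc_eq less_2_cases_iff)

lemma rk_2: "rk 2 = 1"
  by (simp add: numeral_2_eq_2)

lemma rk_ge3: "3 \<le> k \<Longrightarrow> rk k = 0"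
  by (cases k rule: rk.cases) auto

lemma Chains_2: "c \<in> Chains a b 2 \<longleftrightarrow> c 0 \<in> L \<and> (\<forall>i>0. c i = 0)"
  by (auto simp: Chains_def rk_2 One_nat_def Suc_le_eq)

lemma Chains_ge3: "3 \<le> k \<Longrightarrow> Chains a b k = {0}"
  by (auto simp: Chains_def rk_ge3 fun_eq_iff)

lemma Rel_1: "c \<in> Rel a b 1 \<longleftrightarrow> c \<in> Chains a b 1 \<and>
    (\<forall>p q. p \<noteq> a - 1 \<longrightarrow> c 0 (p, q) = 0) \<and> (\<forall>p q. q \<noteq> b - 1 \<longrightarrow> c 1 (p, q) = 0)"
proof -
  have "c \<in> Rel a b 1 \<longleftrightarrow> (\<forall>i>1. c i = 0) \<and> (\<exists>m\<in>L. c 0 = mono (a - 1) 0 \<odot> m) \<and>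
      (\<exists>m\<in>L. c 1 = mono 0 (b - 1) \<odot> m)" (is "?l \<longleftrightarrow> ?r")
  proof
    assume ?r
    then obtain m0 m1 where m: "m0 \<in> L" "c 0 = mono (a - 1) 0 \<odot> m0" "m1 \<in> L"
      "c 1 = mono 0 (b - 1) \<odot> m1" and z: "\<And>i. i > 1 \<Longrightarrow> c i = 0" by blast
    have "c = (\<lambda>i. if i = 0 then mono (a - 1) 0 \<odot> m0 else if i = 1 then mono 0 (b - 1) \<odot> m1 else 0)"
      by (rule ext) (use z m in \<open>auto simp: One_nat_def\<close>)
    with m show ?l unfolding Rel_def by (simp only: if_True simp_thms mem_Collect_eq) blast
  qed (auto simp: Rel_def)
  then show ?thesis by (auto simp: X_top_image Y_top_image Chains_1)
qed

lemma Rel_2: "c \<in> Rel a b 2 \<longleftrightarrow> c \<in> Chains a b 2 \<and>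
    (\<forall>p q. p \<noteq> a - 1 \<longrightarrow> q \<noteq> b - 1 \<longrightarrow> c 0 (p, q) = 0)" (is "_ \<longleftrightarrow> ?r")
proof
  assume "c \<in> Rel a b 2"
  then obtain m m' where "c = (\<lambda>i. if i = 0 then mono (a - 1) 0 \<odot> m + mono 0 (b - 1) \<odot> m' else 0)"
    by (auto simp: Rel_def)
  then show ?r by (auto simp: Chains_2 mono_lmul_apply Lam_closed)
next
  assume c: ?r
  \<comment> \<open>The column \<open>p = a - 1\<close> goes entirely to the X part, so the shared
    corner is counted once.\<close>
  define f g :: elt where "f = (\<lambda>(p, q). if p = a - 1 then c 0 (p, q) else 0)"
    and "g = (\<lambda>(p, q). if p = a - 1 then 0 else c 0 (p, q))"
  have "f \<in> L \<and> (\<forall>p q. p \<noteq> a - 1 \<longrightarrow> f (p, q) = 0)" "g \<in> L \<and> (\<forall>p q. q \<noteq> b - 1 \<longrightarrow> g (p, q) = 0)"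
    using c by (auto simp: f_def g_def Chains_2 Lam_def)
  then obtain m m' where m: "m \<in> L" "f = mono (a - 1) 0 \<odot> m" "m' \<in> L" "g = mono 0 (b - 1) \<odot> m'"
    unfolding X_top_image[symmetric] Y_top_image[symmetric] by blast
  have "c 0 = f + g" by (auto simp: f_def g_def fun_eq_iff)
  then have "c = (\<lambda>i. if i = 0 then mono (a - 1) 0 \<odot> m + mono 0 (b - 1) \<odot> m' else 0)"
    using c m by (auto simp: Chains_2 fun_eq_iff)
  with m show "c \<in> Rel a b 2" by (auto simp: Rel_def)
qed

lemma Rel_0: "Rel a b 0 = {0}" and Rel_ge3: "3 \<le> k \<Longrightarrow> Rel a b k = {0}"
  by (auto simp: Rel_def)

lemma zero_Rel: "0 \<in> Rel a b k"
proof -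
  consider "k = 1" | "k = 2" | "k = 0 \<or> 3 \<le> k" by linarith
  then show ?thesis
    by cases (auto simp: Rel_0 Rel_1 Rel_2 Rel_ge3 Chains_1 Chains_2 Lam_closed)
qed

lemma bd_1: "bd a b 1 c = (\<lambda>i. if i = 0 then brX a b (c 0) + brY a b (c 1) else 0)"
  by (simp add: bd_def)

lemma bd_2: "bd a b 2 c = (\<lambda>i. if i = 0 then - brY a b (c 0) - c 0 \<odot> Y
    else if i = 1 then brX a b (c 0) - c 0 \<odot> X else 0)"
  by (simp add: bd_def)

lemma bd_else: "k \<noteq> 1 \<Longrightarrow> k \<noteq> 2 \<Longrightarrow> bd a b k c = 0"
  by (simp add: bd_def)

text \<open>With the indices \<open>a - 1 - p\<close> and \<open>b - 1 - q\<close> the boundary is the transpose of the coboundary.\<close>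

lemma brX_apply: "brX a b m (p, q)
    = (if 0 < p \<and> p < a \<and> q < b then of_nat (b - 1 - q) * m (p - 1, q) else 0)"
  by (auto simp: brX_def of_nat_diff)

lemma brY_apply: "brY a b m (p, q)
    = (if 0 < q \<and> p < a \<and> q < b then - of_nat (a - 1 - p) * m (p, q - 1) else 0)"
  by (auto simp: brY_def of_nat_diff)

lemma br_closed: "brX a b m \<in> L" "brY a b m \<in> L"
  by (auto simp: Lam_def brX_def brY_def)

text \<open>The correction terms \<open>mX\<close> and \<open>mY\<close> lower the weights once
  more. On the edges \<open>p = a - 1\<close> and \<open>q = b - 1\<close> the weight is -1, not a
  truncated natural difference, hence the separate cases; these entries lie in
  \<open>Rel a b 1\<close>.\<close>

lemma bd_2_apply:
  "bd a b 2 c 0 (p, q) = (if 0 < q \<and> p + 1 < a \<and> q < b then of_nat (a - 2 - p) * c 0 (p, q - 1)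
     else if 0 < q \<and> p + 1 = a \<and> q < b then - c 0 (p, q - 1) else 0)"
  "bd a b 2 c 1 (p, q) = (if 0 < p \<and> p < a \<and> q + 1 < b then of_nat (b - 2 - q) * c 0 (p - 1, q)
     else if 0 < p \<and> p < a \<and> q + 1 = b then - c 0 (p - 1, q) else 0)"
proof -
  have "complex_of_nat (a - 1 - p) = of_nat (a - 2 - p) + 1" if "p + 1 < a"
    using that by (simp add: of_nat_diff)
  then show "bd a b 2 c 0 (p, q) = (if 0 < q \<and> p + 1 < a \<and> q < b then of_nat (a - 2 - p) * c 0 (p, q - 1)
     else if 0 < q \<and> p + 1 = a \<and> q < b then - c 0 (p, q - 1) else 0)"
    by (auto simp: bd_2 brY_apply lmul_comm[of _ Y] Y_lmul_apply distrib_right left_diff_distrib)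
  have "complex_of_nat (b - 1 - q) = of_nat (b - 2 - q) + 1" if "q + 1 < b"
    using that by (simp add: of_nat_diff)
  then show "bd a b 2 c 1 (p, q) = (if 0 < p \<and> p < a \<and> q + 1 < b then of_nat (b - 2 - q) * c 0 (p - 1, q)
     else if 0 < p \<and> p < a \<and> q + 1 = b then - c 0 (p - 1, q) else 0)"
    by (auto simp: bd_2 brX_apply lmul_comm[of _ X] X_lmul_apply distrib_right left_diff_distrib)
qed

section \<open>Cycles and boundaries degree by degree\<close>

lemma HZ_0: "HZ a b 0 = Chains a b 0"
  by (auto simp: HZ_def Rel_0 bd_else)

lemma HB_0: "HB a b 0 = bd a b 1 ` Chains a b 1"
  by (auto simp: HB_def Rel_0)

text \<open>Dual to the computation of Casimirs: every other position receives a nonzero multiple of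
  some chain coefficient.\<close>

lemma HB_0_iff:
  assumes c: "c \<in> Chains a b 0"
  shows "c \<in> HB a b 0 \<longleftrightarrow> c 0 (a - 1, b - 1) = 0 \<and> c 0 (0, 0) = 0"
proof
  assume "c \<in> HB a b 0"
  then show "c 0 (a - 1, b - 1) = 0 \<and> c 0 (0, 0) = 0"
    by (auto simp: HB_0 bd_1 brX_apply brY_apply)
next
  assume z: "c 0 (a - 1, b - 1) = 0 \<and> c 0 (0, 0) = 0"
  define m where "m = c 0"
  have m: "m \<in> L" using c by (simp add: m_def Chains_0)
  \<comment> \<open>Positions with \<open>p > 0\<close> and \<open>q < b - 1\<close> are hit through
    \<open>x\<close> alone, those with \<open>p = 0\<close> or \<open>q = b - 1\<close> through
    \<open>y\<close> alone.\<close>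
  define x y :: elt
    where "x = (\<lambda>(p, q). if q + 1 < b then m (p + 1, q) / of_nat (b - 1 - q) else 0)"
      and "y = (\<lambda>(p, q). if (p = 0 \<or> q + 2 = b) \<and> p + 1 < a
                  then - m (p, q + 1) / of_nat (a - 1 - p) else 0)"
  have xy: "x \<in> L" "y \<in> L"
    using m b2 by (auto simp: x_def y_def Lam_def)
  let ?d = "\<lambda>i :: nat. if i = 0 then x else if i = 1 then y else 0"
  have "m (p, q) = (brX a b x + brY a b y) (p, q)" for p q
  proof (cases "p < a \<and> q < b")
    case True
    show ?thesis
    proof (cases "0 < p \<and> q + 1 < b")
      case True
      then show ?thesis using \<open>p < a \<and> q < b\<close>
        by (auto simp: brX_apply brY_apply x_def y_def)
    next
      case False
      have "q = b - 1" if "\<not> q + 1 < b" using that True by auto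
      with False show ?thesis using True z a2 b2
        by (cases "p + 1 = a"; cases "q = 0") (auto simp: brX_apply brY_apply x_def y_def m_def)
    qed
  next
    case False
    then show ?thesis using m by (auto simp: brX_apply brY_apply LamD)
  qed
  then have "m = brX a b x + brY a b y" by auto
  then have "c = bd a b 1 ?d"
    using c by (auto simp: fun_eq_iff bd_1 m_def Chains_0)
  moreover have "?d \<in> Chains a b 1" using xy by (simp add: Chains_1)
  ultimately show "c \<in> HB a b 0" unfolding HB_0 by blast
qed

lemma HZ_1_iff: "c \<in> HZ a b 1 \<longleftrightarrow> c \<in> Chains a b 1 \<and> brX a b (c 0) + brY a b (c 1) = 0"
  by (auto simp: HZ_def Rel_0 bd_1 fun_eq_iff)

lemma HB_1: "HB a b 1 = {bd a b 2 c + n | c n. c \<in> Chains a b 2 \<and> n \<in> Rel a b 1}"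
  by (simp add: HB_def)

text \<open>Dual to \<open>HPB_1_iff\<close>: the two exceptional positions reflect to
  \<open>(1, 0)\<close> and \<open>(0, 1)\<close>, the coefficients of the Euler
  derivations.\<close>

lemma HB_1_iff:
  assumes c: "c \<in> HZ a b 1"
  shows "c \<in> HB a b 1 \<longleftrightarrow> c 0 (a - 2, b - 1) = 0 \<and> c 1 (a - 1, b - 2) = 0"
proof
  assume "c \<in> HB a b 1"
  then show "c 0 (a - 2, b - 1) = 0 \<and> c 1 (a - 1, b - 2) = 0"
    using a2 b2 by (auto simp: HB_1 Rel_1 bd_2_apply)
next
  assume z: "c 0 (a - 2, b - 1) = 0 \<and> c 1 (a - 1, b - 2) = 0"
  define x y where "x = c 0" and "y = c 1"
  have xy: "x \<in> L" "y \<in> L" and cyc: "brX a b x + brY a b y = 0" and c1: "c \<in> Chains a b 1"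
    using c by (auto simp: HZ_1_iff Chains_1 x_def y_def)
  have cyc': "brX a b x (p, q) + brY a b y (p, q) = 0" for p q
    using fun_cong[OF cyc, of "(p, q)"] by simp
  have rel: "of_nat (b - 2 - q) * x (p, q + 1) = of_nat (a - 2 - p) * y (p + 1, q)"
    if "p + 1 < a" "q + 1 < b" for p q
  proof -
    have "b - 1 - (q + 1) = b - 2 - q" "a - 1 - (p + 1) = a - 2 - p" by auto
    with cyc'[of "p + 1" "q + 1"] that show ?thesis by (simp add: brX_apply brY_apply)
  qed
  \<comment> \<open>Boundaries do not reach the edges \<open>x (p, 0)\<close> and
    \<open>y (0, q)\<close>; the cycle condition makes them vanish.\<close>
  have x0: "x (p, 0) = 0" if "p + 1 < a" for p
    using cyc'[of "p + 1" 0] that b2 by (simp add: brX_apply brY_apply)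
  have y0: "y (0, q) = 0" if "q + 1 < b" for q
    using cyc'[of 0 "q + 1"] that a2 by (simp add: brX_apply brY_apply)
  \<comment> \<open>Divide by \<open>a - 2 - p\<close> where possible, otherwise by
    \<open>b - 2 - q\<close>. At \<open>(a - 2, b - 2)\<close> both weights vanish and the two
    assumed zeros take over.\<close>
  define e :: elt where "e = (\<lambda>(p, q). if p + 1 < a \<and> q + 1 < b then
      if p + 2 < a then x (p, q + 1) / of_nat (a - 2 - p)
      else if q + 2 < b then y (p + 1, q) / of_nat (b - 2 - q) else 0 else 0)"
  let ?e = "\<lambda>i :: nat. if i = 0 then e else 0"
  have e: "?e \<in> Chains a b 2" by (auto simp: Chains_2 e_def Lam_def)
  have ex: "of_nat (a - 2 - p) * e (p, q) = x (p, q + 1)" if "p + 1 < a" "q + 1 < b" for p q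
  proof (cases "p + 2 < a")
    case False
    then have "p = a - 2" "q + 2 < b \<or> q + 1 = b - 1" using that by auto
    then show ?thesis using rel[OF that] z that
      by (cases "q + 2 < b") (auto simp: x_def)
  qed (use that in \<open>simp add: e_def\<close>)
  have ey: "of_nat (b - 2 - q) * e (p, q) = y (p + 1, q)" if "p + 1 < a" "q + 1 < b" for p q
  proof (cases "p + 2 < a")
    case True
    then show ?thesis using rel[OF that] that by (simp add: e_def field_simps)
  next
    case False
    then have "p + 1 = a - 1" "q + 2 < b \<or> q = b - 2" using that by auto
    then show ?thesis using False z that
      by (cases "q + 2 < b") (auto simp: e_def y_def)
  qed
  \<comment> \<open>What remains sits on \<open>p = a - 1\<close> for dX and
    \<open>q = b - 1\<close> for dY.\<close>
  have "c - bd a b 2 ?e \<in> Rel a b 1"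
    unfolding Rel_1
  proof (intro conjI allI impI)
    show "c - bd a b 2 ?e \<in> Chains a b 1"
      using c1 by (auto simp: Chains_1 bd_2 Lam_closed br_closed)
    show "(c - bd a b 2 ?e) 0 (p, q) = 0" if "p \<noteq> a - 1" for p q
      using that x0[of p] ex[of p "q - 1"] LamD[OF xy(1), of p q]
      by (cases "p < a \<and> q < b"; cases "q = 0") (auto simp: bd_2_apply x_def)
    show "(c - bd a b 2 ?e) 1 (p, q) = 0" if "q \<noteq> b - 1" for p q
      using that y0[of q] ey[of "p - 1" q] LamD[OF xy(2), of p q]
      by (cases "p < a \<and> q < b"; cases "p = 0") (auto simp: bd_2_apply y_def)
  qed
  then show "c \<in> HB a b 1"
    unfolding HB_1 mem_Collect_eq
    by (intro exI[of _ ?e] exI[of _ "c - bd a b 2 ?e"] conjI e) simp_all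
qed

lemma HZ_2: "HZ a b 2 = {c \<in> Chains a b 2. bd a b 2 c \<in> Rel a b 1}"
  by (simp add: HZ_def One_nat_def)

lemma HB_2: "HB a b 2 = Rel a b 2"
  by (auto simp: HB_def bd_else Chains_ge3)

text \<open>The boundaries are just the relations. The cycle condition kills the coefficients with
  \<open>p < a - 1\<close> and \<open>q < b - 1\<close> except where both weights vanish.\<close>

lemma HB_2_iff:
  assumes "c \<in> HZ a b 2"
  shows "c \<in> HB a b 2 \<longleftrightarrow> c 0 (a - 2, b - 2) = 0"
proof -
  have c: "c \<in> Chains a b 2" and r: "bd a b 2 c \<in> Rel a b 1" using assms by (auto simp: HZ_2)
  have "of_nat (a - 2 - p) * c 0 (p, q) = 0" "of_nat (b - 2 - q) * c 0 (p, q) = 0"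
    if "p + 1 < a" "q + 1 < b" for p q
  proof -
    have "bd a b 2 c 0 (p, q + 1) = 0" "bd a b 2 c 1 (p + 1, q) = 0"
      using r that by (simp_all add: Rel_1)
    then show "of_nat (a - 2 - p) * c 0 (p, q) = 0" "of_nat (b - 2 - q) * c 0 (p, q) = 0"
      using that by (simp_all add: bd_2_apply)
  qed
  then have z: "c 0 (p, q) = 0" if "p + 1 < a" "q + 1 < b" "(p, q) \<noteq> (a - 2, b - 2)" for p q
    using that by force
  have "(\<forall>p q. p \<noteq> a - 1 \<longrightarrow> q \<noteq> b - 1 \<longrightarrow> c 0 (p, q) = 0) \<longleftrightarrow> c 0 (a - 2, b - 2) = 0"
  proof
    assume *: "c 0 (a - 2, b - 2) = 0"
    show "\<forall>p q. p \<noteq> a - 1 \<longrightarrow> q \<noteq> b - 1 \<longrightarrow> c 0 (p, q) = 0"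
    proof (intro allI impI)
      fix p q assume "p \<noteq> a - 1" "q \<noteq> b - 1"
      then have "p + 1 < a \<or> \<not> p < a" "q + 1 < b \<or> \<not> q < b" by auto
      then show "c 0 (p, q) = 0"
        using z[of p q] * c LamD[of "c 0" p q]
        by (cases "p + 1 < a \<and> q + 1 < b") (auto simp: Chains_2)
    qed
  qed (use a2 b2 in auto)
  with c show ?thesis by (simp add: HB_2 Rel_2)
qed

section \<open>Comparison\<close>

text \<open>In each degree the isomorphism reads off the coefficients of multidegree \<open>(0, 0)\<close> (and, for
  \<open>k = 0\<close>, also \<open>(a - 1, b - 1)\<close>) of a cocycle: all other multidegrees are acyclic.\<close>

lemma iso_0: "sq_iso scC scV (HPZ a b 0) (HPB a b 0) (HZ a b 0) (HB a b 0)"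
proof -
  \<comment> \<open>The reflection exchanges the corners: the coefficient of 1 goes to the top
    monomial and conversely.\<close>
  define F :: "((nat \<Rightarrow> elt) \<Rightarrow> elt) \<Rightarrow> nat \<Rightarrow> elt" where
    "F = (\<lambda>P i. if i = 0 then scE (P 0 (0, 0)) (mono (a - 1) (b - 1))
       + scE (P 0 (a - 1, b - 1)) (mono 0 0) else 0)"
  have F0: "F P 0 (a - 1, b - 1) = P 0 (0, 0)" "F P 0 (0, 0) = P 0 (a - 1, b - 1)" for P
    using a2 b2 by (auto simp: F_def monoL_def)
  have F_chain: "F P \<in> Chains a b 0" for P
    by (simp add: F_def Chains_0 Lam_closed)
  show ?thesis
    unfolding sq_iso_def HZ_0
  proof (intro exI[of _ F] conjI ballI allI)
    show "F (P + scC c R) = F P + scV c (F R)" for P R c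
      by (auto simp: F_def scC_def scV_def fun_eq_iff algebra_simps)
    show "F ` HPZ a b 0 \<subseteq> Chains a b 0" using F_chain by blast
    show "\<exists>P\<in>HPZ a b 0. z - F P \<in> HB a b 0" if z: "z \<in> Chains a b 0" for z
    proof (rule bexI)
      define g where "g = scE (z 0 (a - 1, b - 1)) (mono 0 0) + scE (z 0 (0, 0)) (mono (a - 1) (b - 1))"
      have "z - F (\<lambda>_. g) \<in> Chains a b 0"
        using z F_chain[of "\<lambda>_. g"] by (auto simp: Chains_0 Lam_closed)
      then show "z - F (\<lambda>_. g) \<in> HB a b 0"
        unfolding HB_0_iff[OF \<open>z - F (\<lambda>_. g) \<in> Chains a b 0\<close>]
        using a2 b2 by (simp add: F0) (simp add: g_def monoL_def)
      show "(\<lambda>_. g) \<in> HPZ a b 0"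
        unfolding HPZ_0_iff
      proof (intro bexI[of _ g] conjI allI impI refl)
        show "g \<in> L" by (simp add: g_def Lam_closed)
      qed (auto simp: g_def monoL_def)
    qed
    show "F P \<in> HB a b 0 \<longleftrightarrow> P \<in> HPB a b 0" if P: "P \<in> HPZ a b 0" for P
    proof -
      obtain g where g: "P = (\<lambda>_. g)"
        and supp: "\<And>p q. (p, q) \<noteq> (0, 0) \<Longrightarrow> (p, q) \<noteq> (a - 1, b - 1) \<Longrightarrow> g (p, q) = 0"
        using P unfolding HPZ_0_iff by blast
      \<comment> \<open>There are no nonzero coboundaries in degree 0, so \<open>F\<close> has to be
        injective on the Casimirs.\<close>
      have "P = 0 \<longleftrightarrow> g = 0" by (auto simp: g fun_eq_iff)
      also have "\<dots> \<longleftrightarrow> g (0, 0) = 0 \<and> g (a - 1, b - 1) = 0"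
      proof
        assume z: "g (0, 0) = 0 \<and> g (a - 1, b - 1) = 0"
        have "g x = 0" for x using supp[of "fst x" "snd x"] z
          by (cases "x = (0, 0)"; cases "x = (a - 1, b - 1)") auto
        then show "g = 0" by auto
      qed auto
      finally show ?thesis by (simp add: HB_0_iff[OF F_chain] F0 HPB_def g)
    qed
  qed
qed

lemma iso_1: "sq_iso scC scV (HPZ a b 1) (HPB a b 1) (HZ a b 1) (HB a b 1)"
proof -
  define F :: "((nat \<Rightarrow> elt) \<Rightarrow> elt) \<Rightarrow> nat \<Rightarrow> elt" where
    "F = (\<lambda>P i. if i = 0 then scE (P (\<lambda>_. X) (1, 0)) (mono (a - 2) (b - 1))
       else if i = 1 then scE (P (\<lambda>_. Y) (0, 1)) (mono (a - 1) (b - 2)) else 0)"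
  have F0: "F P 0 (a - 2, b - 1) = P (\<lambda>_. X) (1, 0)" "F P 1 (a - 1, b - 2) = P (\<lambda>_. Y) (0, 1)" for P
    using a2 b2 by (auto simp: F_def monoL_def)
  have F_cycle: "F P \<in> HZ a b 1" for P
    unfolding HZ_1_iff
  proof
    show "F P \<in> Chains a b 1" by (simp add: F_def Chains_1 Lam_closed)
    show "brX a b (F P 0) + brY a b (F P 1) = 0"
      using a2 b2 by (auto simp: F_def fun_eq_iff brX_apply brY_apply monoL_def)
  qed
  show ?thesis
    unfolding sq_iso_def
  proof (intro exI[of _ F] conjI ballI allI)
    show "F (P + scC c R) = F P + scV c (F R)" for P R c
      by (auto simp: F_def scC_def scV_def fun_eq_iff algebra_simps)
    show "F ` HPZ a b 1 \<subseteq> HZ a b 1" using F_cycle by blast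
    show "\<exists>P\<in>HPZ a b 1. z - F P \<in> HB a b 1" if z: "z \<in> HZ a b 1" for z
    proof (rule bexI)
      \<comment> \<open>\<open>F\<close> reads the two scalars of an Euler derivation, so this
        choice matches both coefficients that detect the class of \<open>z\<close>.\<close>
      let ?P = "eulerP (z 0 (a - 2, b - 1)) (z 1 (a - 1, b - 2))"
      have "brX a b (f - g) + brY a b (f' - g')
          = (brX a b f + brY a b f') - (brX a b g + brY a b g')" for f g f' g'
        by (auto simp: fun_eq_iff brX_def brY_def algebra_simps)
      then have d: "z - F ?P \<in> HZ a b 1"
        using z F_cycle[of ?P] by (auto simp: HZ_1_iff Chains_1 Lam_closed)
      show "z - F ?P \<in> HB a b 1"
        unfolding HB_1_iff[OF d] using a2 b2
        by (simp add: F0 eulerP_values) (simp add: monoL_def)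
    qed (rule eulerP_cocycle)
    show "F P \<in> HB a b 1 \<longleftrightarrow> P \<in> HPB a b 1" if "P \<in> HPZ a b 1" for P
      by (simp add: HB_1_iff[OF F_cycle] HPB_1_iff[OF that] F0)
  qed
qed

lemma iso_2: "sq_iso scC scV (HPZ a b 2) (HPB a b 2) (HZ a b 2) (HB a b 2)"
proof -
  let ?XY = "pcons X (\<lambda>_. Y)"
  define F :: "((nat \<Rightarrow> elt) \<Rightarrow> elt) \<Rightarrow> nat \<Rightarrow> elt" where
    "F = (\<lambda>P i. if i = 0 then scE (P ?XY (1, 1)) (mono (a - 2) (b - 2)) else 0)"
  have F0: "F P 0 (a - 2, b - 2) = P ?XY (1, 1)" for P
    using a2 b2 by (auto simp: F_def monoL_def)
  have F_cycle: "F P \<in> HZ a b 2" for P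
  proof -
    have "F P \<in> Chains a b 2" by (simp add: F_def Chains_2 Lam_closed)
    moreover have "bd a b 2 (F P) \<in> Chains a b 1"
      by (auto simp: Chains_1 bd_2 Lam_closed br_closed)
    \<comment> \<open>At the only nonzero coefficient of \<open>F P 0\<close> both weights
      vanish.\<close>
    moreover have "of_nat (a - 2 - p) * F P 0 (p, q) = 0" "of_nat (b - 2 - q) * F P 0 (p, q) = 0" for p q
      by (auto simp: F_def monoL_def)
    ultimately show ?thesis by (auto simp: HZ_2 Rel_1 bd_2_apply simp del: mult_eq_0_iff)
  qed
  \<comment> \<open>The normalisation \<open>{X, Y} = XY\<close> lets a scalar multiple of the
    bracket attain any prescribed class.\<close>
  have brXY: "brP ?XY (1, 1) = 1"
    using a2 b2 by (simp add: brP_def Lam_closed pbr_X X_lmul_apply Ey_def) (simp add: monoL_def)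
  show ?thesis
    unfolding sq_iso_def
  proof (intro exI[of _ F] conjI ballI allI)
    show "F (P + scC c R) = F P + scV c (F R)" for P R c
      by (auto simp: F_def scC_def scV_def fun_eq_iff algebra_simps)
    show "F ` HPZ a b 2 \<subseteq> HZ a b 2" using F_cycle by blast
    show "\<exists>P\<in>HPZ a b 2. z - F P \<in> HB a b 2" if z: "z \<in> HZ a b 2" for z
    proof (rule bexI)
      let ?P = "scC (z 0 (a - 2, b - 2)) brP"
      have "bd a b 2 (z - F ?P) = bd a b 2 z - bd a b 2 (F ?P)"
        by (auto simp: fun_eq_iff bd_2 brX_def brY_def lmul_linear algebra_simps)
      then have d: "z - F ?P \<in> HZ a b 2"
        using z F_cycle[of ?P] by (auto simp: HZ_2 Rel_1 Chains_1 Chains_2 Lam_closed)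
      show "z - F ?P \<in> HB a b 2"
        unfolding HB_2_iff[OF d] by (simp add: F0) (simp add: scC_def brXY)
      show "?P \<in> HPZ a b 2"
        using kder_scC[OF brP_kder] by (simp add: HPZ_def delta_scC delta_brP)
          (simp add: scC_def scE_linear fun_eq_iff)
    qed
    show "F P \<in> HB a b 2 \<longleftrightarrow> P \<in> HPB a b 2" if "P \<in> HPZ a b 2" for P
      using that by (simp add: HB_2_iff[OF F_cycle] HPB_2_iff F0 HPZ_def)
  qed
qed

text \<open>Both quotients are zero: cocycles vanish by \<open>kder_ge3\<close>, and there are no
  nonzero chains above degree 2.\<close>

lemma iso_ge3:
  assumes "3 \<le> k"
  shows "sq_iso scC scV (HPZ a b k) (HPB a b k) (HZ a b k) (HB a b k)"
proof -
  have "HPZ a b k \<subseteq> {0}" using kder_ge3[OF assms] by (auto simp: HPZ_def)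
  moreover have "0 \<in> HPZ a b k" by (simp add: HPZ_def zero_kder delta_zero)
  moreover have "0 \<in> HPB a b k"
    using assms zero_kder[of "k - 1"] by (auto simp: HPB_def intro!: image_eqI[of _ _ 0] simp: delta_zero)
  moreover have bd: "bd a b k c = 0" "bd a b (k + 1) c = 0" for c
    using assms by (simp_all add: bd_else)
  moreover have "HZ a b k = {0}" using assms bd zero_Rel by (auto simp: HZ_def Chains_ge3)
  moreover have "(0 :: nat \<Rightarrow> elt) \<in> HB a b k"
    unfolding HB_def mem_Collect_eq
    by (intro exI[of _ 0]) (use assms bd in \<open>simp add: Chains_ge3 Rel_ge3\<close>)
  ultimately show ?thesis
    unfolding sq_iso_def
    by (intro exI[of _ "\<lambda>_. 0"]) (auto simp: scV_def scE_linear fun_eq_iff)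
qed

end

theorem theorem2:
  fixes a b k :: nat
  assumes "2 \<le> a" and "2 \<le> b"
  shows "sq_iso scC scV (HPZ a b k) (HPB a b k) (HZ a b k) (HB a b k)"
proof -
  interpret truncated a b using assms by unfold_locales
  consider "k = 0" | "k = 1" | "k = 2" | "3 \<le> k" by linarith
  then show ?thesis by cases (use iso_0 iso_1 iso_2 iso_ge3 in auto)
qed

end
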